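(* Let $\Omega=\mathbb R^2\times(0,1)$, $\alpha>0$, and let $(\mathbf u,P)$ be a smooth axisymmetric solution of $-\Delta\mathbf u+(\mathbf u\cdot\nabla)\mathbf u+\nabla P=0$, $\nabla\cdot\mathbf u=0$ in $\Omega$ satisfying the Navier boundary conditions with friction coefficient $\alpha$ on $\partial\Omega$. If $$\lim_{R\to+\infty}R^{-1}\sup_{z\in[0,1]}|\mathbf u(R,z)|=0,$$ then $\mathbf u\equiv0$.
   Context: Navier boundary conditions with friction coefficient $\alpha$: $\mathbf u\cdot\mathbf n=0$ and $(\mathbf n\cdot\mathbb D(\mathbf u)+\alpha\mathbf u)\cdot\mathbf t=0$ on $\partial\Omega$, with $\mathbb D(\mathbf u)_{ij}=(\partial_{x_j}u^i+\partial_{x_i}u^j)/2$; equivalently $u^3=0$, $\mp\frac12\partial_{x_3}u^1+\alpha u^1=0$, $\mp\frac12\partial_{x_3}u^2+\alpha u^2=0$ at $x_3=0$ (upper sign) and $x_3=1$ (lower sign). In cylindrical coordinates $\mathbf x=(r\cos\theta,r\sin\theta,z)$, $\mathbf u=u^r\mathbf e_r+u^\theta\mathbf e_\theta+u^z\mathbf e_z$ ($\mathbf e_r=(\cos\theta,\sin\theta,0)$, $\mathbf e_\theta=(-\sin\theta,\cos\theta,0)$, $\mathbf e_z=(0,0,1)$); $\mathbf u$ is axisymmetric if $(u^r,u^\theta,u^z)$ does not depend on $\theta$, and then $\mathbf u(R,z)$ denotes the value at $r=R$, height $z$. *)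

theory Defs
  imports "HOL-Analysis.Analysis"
begin

definition slab_closed :: "(real^3) set" where
  "slab_closed = {x. 0 \<le> x$3 \<and> x$3 \<le> 1}"

definition slab_open :: "(real^3) set" where
  "slab_open = {x. 0 < x$3 \<and> x$3 < 1}"

text \<open>Partial derivative in direction e_i, taken within a set S
  (one-sided at the boundary of the closed slab).\<close>
definition pd :: "(real^3) set \<Rightarrow> 3 \<Rightarrow> (real^3 \<Rightarrow> real) \<Rightarrow> real^3 \<Rightarrow> real" where
  "pd S i f x = frechet_derivative f (at x within S) (axis i 1)"

fun Ck_on :: "nat \<Rightarrow> (real^3) set \<Rightarrow> (real^3 \<Rightarrow> real) \<Rightarrow> bool" where
  "Ck_on 0 S f = continuous_on S f"
| "Ck_on (Suc k) S f = ((\<forall>x\<in>S. f differentiable (at x within S)) \<and> (\<forall>i. Ck_on k S (pd S i f)))"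

definition smooth_on :: "(real^3) set \<Rightarrow> (real^3 \<Rightarrow> real) \<Rightarrow> bool" where
  "smooth_on S f = (\<forall>k. Ck_on k S f)"

abbreviation D :: "3 \<Rightarrow> (real^3 \<Rightarrow> real) \<Rightarrow> real^3 \<Rightarrow> real" where
  "D \<equiv> pd slab_closed"

definition stationary_NS :: "(real^3 \<Rightarrow> real^3) \<Rightarrow> (real^3 \<Rightarrow> real) \<Rightarrow> bool" where
  "stationary_NS u P = (\<forall>x\<in>slab_open.
     (\<forall>i. - (\<Sum>j\<in>UNIV. D j (D j (\<lambda>y. u y $ i)) x)
          + (\<Sum>j\<in>UNIV. u x $ j * D j (\<lambda>y. u y $ i) x)
          + D i P x = 0)
   \<and> (\<Sum>j\<in>UNIV. D j (\<lambda>y. u y $ j) x) = 0)"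

definition navier_bc :: "real \<Rightarrow> (real^3 \<Rightarrow> real^3) \<Rightarrow> bool" where
  "navier_bc \<alpha> u = (\<forall>x\<in>slab_closed.
     (x$3 = 0 \<longrightarrow> u x $ 3 = 0
        \<and> - (1/2) * D 3 (\<lambda>y. u y $ 1) x + \<alpha> * u x $ 1 = 0
        \<and> - (1/2) * D 3 (\<lambda>y. u y $ 2) x + \<alpha> * u x $ 2 = 0)
   \<and> (x$3 = 1 \<longrightarrow> u x $ 3 = 0
        \<and> (1/2) * D 3 (\<lambda>y. u y $ 1) x + \<alpha> * u x $ 1 = 0
        \<and> (1/2) * D 3 (\<lambda>y. u y $ 2) x + \<alpha> * u x $ 2 = 0))"

definition cyl :: "real \<Rightarrow> real \<Rightarrow> real \<Rightarrow> real^3" where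
  "cyl r \<theta> z = vector [r * cos \<theta>, r * sin \<theta>, z]"

definition e_r :: "real \<Rightarrow> real^3" where "e_r \<theta> = vector [cos \<theta>, sin \<theta>, 0]"
definition e_\<theta> :: "real \<Rightarrow> real^3" where "e_\<theta> \<theta> = vector [- sin \<theta>, cos \<theta>, 0]"
definition e_z :: "real^3" where "e_z = vector [0, 0, 1]"

definition axisymmetric :: "(real^3 \<Rightarrow> real^3) \<Rightarrow> bool" where
  "axisymmetric u = (\<forall>r>0. \<forall>z \<theta> \<theta>'.
      u (cyl r \<theta> z) \<bullet> e_r \<theta> = u (cyl r \<theta>' z) \<bullet> e_r \<theta>'
    \<and> u (cyl r \<theta> z) \<bullet> e_\<theta> \<theta> = u (cyl r \<theta>' z) \<bullet> e_\<theta> \<theta>'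
    \<and> u (cyl r \<theta> z) \<bullet> e_z = u (cyl r \<theta>' z) \<bullet> e_z)"

end

theory Submission
  imports Defs
begin

text \<open>
  Axisymmetry and incompressibility give a stream function \<open>Q\<close> with
  \<open>\<nabla>Q = (x u\<^sub>3, y u\<^sub>3, - x u\<^sub>1 - y u\<^sub>2)\<close> that vanishes on both walls. For a radial cutoff
  \<open>\<phi>(x, y) = g(x\<^sup>2 + y\<^sup>2)\<close> the field \<open>w = \<phi> u + 2 g' Q e\<^sub>3\<close> is therefore divergence free and tangential
  to the walls, so testing the momentum equation with \<open>w\<close> eliminates the pressure.
  With \<open>\<phi> = (1 - r\<^sup>2/R\<^sup>2)\<^sub>+\<^sup>4\<close> and \<open>|u| \<le> \<epsilon>R\<close> on the support, the error terms are at most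
  \<open>C(\<epsilon> + 1/R)\<close> times the energy on the double radius; hence the weighted energy \<open>F\<close> satisfies
  \<open>F(R) \<le> F(2R)/32\<close> for large \<open>R\<close>. Absorbing the gradient instead gives \<open>F(R) \<le> C R\<^sup>4\<close>.
  Iterating the first bound against the second forces \<open>F = 0\<close>.
\<close>

section \<open>Partial derivatives and integration on a slab\<close>

text \<open>Nothing is known about the size of \<open>P\<close>, so a test field with nonzero
  divergence would leave a pressure term beyond control; this forces the correction by
  \<open>Q\<close>. The correction costs a second derivative of the cutoff: out of the weight
  \<open>cutoff^4\<close> the error terms keep \<open>cutoff^2\<close>. The exponent 4 is made for
  this, since \<open>cutoff^2\<close> is the square root of the weight and Young's inequality can
  then absorb the gradient.

  The velocity need not vanish on the walls, so control of \<open>|u|^2\<close> must come from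
  friction. The vertical derivative of \<open>2\<beta>(2z - 1)|u|^2\<close> carries the wall terms
  into the interior; \<open>\<beta> = min \<alpha> (1/8)\<close> keeps both the wall flux and the
  remaining gradient term of the right sign.

  The growth \<open>R^4\<close> is the bound \<open>|u|^2 \<le> R^2\<close> times the area of order
  \<open>R^2\<close>. One doubling multiplies it by 16, so any doubling constant below 1/16 would
  do; 1/32 leaves a factor 1/2 per step.

  All quantities are polynomial in Cartesian coordinates and the flow, apart from the cutoff and an
  integral in height, so the axis needs no separate treatment in the energy estimates.\<close>

type_synonym point = "real \<times> real \<times> real"

definition slab :: "point set" where
  "slab = UNIV \<times> UNIV \<times> {0..1}"

text \<open>Only derivatives along coordinate lines are recorded, one-sided in height at the walls:
  the form in which iterated integrals use them. Since \<open>f'\<close> is an argument, the rules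
  collected in \<open>partials\<close> compute it from the shape of \<open>f\<close>.\<close>

definition has_partials :: "(point \<Rightarrow> real) \<Rightarrow> (3 \<Rightarrow> point \<Rightarrow> real) \<Rightarrow> bool" where
  "has_partials f f' \<longleftrightarrow> continuous_on slab f \<and> (\<forall>i. continuous_on slab (f' i)) \<and>
     (\<forall>x y. \<forall>z\<in>{0..1}.
        ((\<lambda>t. f (t, y, z)) has_real_derivative f' 1 (x, y, z)) (at x) \<and>
        ((\<lambda>t. f (x, t, z)) has_real_derivative f' 2 (x, y, z)) (at y) \<and>
        ((\<lambda>t. f (x, y, t)) has_real_derivative f' 3 (x, y, z)) (at z within {0..1}))"

lemma has_partials_cont:
  assumes "has_partials f f'"
  shows "continuous_on slab f" "continuous_on slab (f' i)"
  using assms by (auto simp: has_partials_def)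

lemma has_partials_deriv:
  assumes "has_partials f f'" "0 \<le> z" "z \<le> 1"
  shows "((\<lambda>t. f (t, y, z)) has_real_derivative f' 1 (x, y, z)) (at x)"
    "((\<lambda>t. f (x, t, z)) has_real_derivative f' 2 (x, y, z)) (at y)"
    "((\<lambda>t. f (x, y, t)) has_real_derivative f' 3 (x, y, z)) (at z within {0..1})"
  using assms by (auto simp: has_partials_def)

named_theorems partials

lemma has_partials_const [partials]: "has_partials (\<lambda>q. c) (\<lambda>i q. 0)"
  by (auto simp: has_partials_def)

lemma has_partials_add [partials]:
  assumes "has_partials f f'" "has_partials g g'"
  shows "has_partials (\<lambda>q. f q + g q) (\<lambda>i q. f' i q + g' i q)"
  using assms unfolding has_partials_def
  by (auto intro!: continuous_on_add DERIV_add)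

lemma has_partials_minus [partials]:
  assumes "has_partials f f'"
  shows "has_partials (\<lambda>q. - f q) (\<lambda>i q. - f' i q)"
  using assms unfolding has_partials_def
  by (auto intro!: continuous_on_minus DERIV_minus)

lemma has_partials_diff [partials]:
  assumes "has_partials f f'" "has_partials g g'"
  shows "has_partials (\<lambda>q. f q - g q) (\<lambda>i q. f' i q - g' i q)"
  using assms unfolding has_partials_def
  by (auto intro!: continuous_on_diff DERIV_diff)

lemma has_partials_mult [partials]:
  assumes "has_partials f f'" "has_partials g g'"
  shows "has_partials (\<lambda>q. f q * g q) (\<lambda>i q. f' i q * g q + g' i q * f q)"
  using assms unfolding has_partials_def
  by (auto intro!: continuous_on_add continuous_on_mult DERIV_mult)

lemma has_partials_height [partials]:
  "has_partials (\<lambda>q. snd (snd q)) (\<lambda>i q. if i = 3 then 1 else 0)"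
  by (auto simp: has_partials_def intro!: continuous_intros derivative_eq_intros)

lemma has_partials_fst [partials]: "has_partials fst (\<lambda>i q. if i = 1 then 1 else 0)"
  by (auto simp: has_partials_def intro!: continuous_intros derivative_eq_intros)

lemma has_partials_fst_snd [partials]: "has_partials (\<lambda>q. fst (snd q)) (\<lambda>i q. if i = 2 then 1 else 0)"
  by (auto simp: has_partials_def intro!: continuous_intros derivative_eq_intros)

section \<open>The radial cutoff and its powers\<close>

lemma DERIV_max0_power:
  "((\<lambda>t::real. (max 0 t) ^ (n + 2)) has_real_derivative real (n + 2) * (max 0 x) ^ (n + 1)) (at x)"
proof (induction n arbitrary: x)
  case 0
  have *: "((\<lambda>t::real. t * \<bar>t\<bar>) has_real_derivative 2 * \<bar>x\<bar>) (at x)"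
  proof (cases "x = 0")
    case True
    \<comment> \<open>At the origin the difference quotient of \<open>t * |t|\<close> is
      \<open>|h|\<close>.\<close>
    have "((\<lambda>t::real. \<bar>t\<bar>) \<longlongrightarrow> 0) (at 0)"
      by (rule tendsto_eq_intros | simp)+
    hence "((\<lambda>h. ((0 + h) * \<bar>0 + h\<bar> - 0 * \<bar>0\<bar>) / h) \<longlongrightarrow> (0::real)) (at 0)"
      by (rule Lim_transform_eventually) (auto simp: eventually_at_filter)
    thus ?thesis using True by (simp add: DERIV_def)
  next
    case False
    have "((\<lambda>t::real. t * (sgn x * t)) has_real_derivative 2 * \<bar>x\<bar>) (at x)"
      by (auto intro!: derivative_eq_intros simp: abs_sgn)
    thus ?thesis
      by (rule has_field_derivative_transform_within_open[where S = "if x > 0 then {0<..} else {..<0}"])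
         (use False in \<open>auto simp: sgn_if abs_if split: if_splits\<close>)
  qed
  \<comment> \<open>The squared positive part is half of \<open>t^2 + t * |t|\<close>, so the base
    case rests on the derivative of \<open>t * |t|\<close>.\<close>
  have e: "(max 0 t) ^ 2 = (t * t + t * \<bar>t\<bar>) / 2" for t :: real
    by (auto simp: max_def power2_eq_square abs_if)
  have m: "max 0 x = (x + \<bar>x\<bar>) / 2" by (auto simp: max_def abs_if)
  show ?case unfolding add_0 e
    by (rule derivative_eq_intros * refl | simp add: m)+
next
  case (Suc n)
  have e: "(max 0 t) ^ (Suc n + 2) = t * (max 0 t) ^ (n + 2)" for t :: real
    by (auto simp: max_def)
  show ?case unfolding e
    by (rule DERIV_cong[OF DERIV_mult[OF DERIV_ident Suc.IH]])
       (cases "x > 0"; simp add: max_def algebra_simps)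
qed

definition cutoff :: "real \<Rightarrow> point \<Rightarrow> real" where
  "cutoff R q = max 0 (1 - ((fst q)\<^sup>2 + (fst (snd q))\<^sup>2) / R\<^sup>2)"

text \<open>This is the gradient before truncation at 0. The truncated function has a corner at
  \<open>r = R\<close>, but the derivative of its power \<open>n + 2\<close> carries the factor
  \<open>cutoff R q ^ (n + 1)\<close>, which vanishes there and beyond.\<close>

definition cutoff_deriv :: "real \<Rightarrow> 3 \<Rightarrow> point \<Rightarrow> real" where
  "cutoff_deriv R i q = (if i = 1 then - 2 * fst q / R\<^sup>2 else if i = 2 then - 2 * fst (snd q) / R\<^sup>2 else 0)"

lemma has_partials_cutoff_power:
  "has_partials (\<lambda>q. cutoff R q ^ (n + 2)) (\<lambda>i q. real (n + 2) * cutoff R q ^ (n + 1) * cutoff_deriv R i q)"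
proof -
  have c: "continuous_on slab (\<lambda>q. cutoff R q ^ m)" for m
    \<comment> \<open>Division by zero yields 0, so for \<open>R = 0\<close> the cutoff is
      constantly 1 and \<open>cutoff_deriv\<close> is 0, and the claim still holds.\<close>
    unfolding cutoff_def by (cases "R = 0"; auto intro!: continuous_intros continuous_on_max)
  have d: "continuous_on slab (\<lambda>q. cutoff_deriv R i q)" for i
    unfolding cutoff_deriv_def
    by (cases "R = 0"; cases "i = 1"; cases "i = 2"; auto intro!: continuous_intros)
  have dx: "((\<lambda>t. 1 - (t\<^sup>2 + y\<^sup>2) / R\<^sup>2) has_real_derivative - 2 * x / R\<^sup>2) (at x)" for x y
    by (cases "R = 0"; auto intro!: derivative_eq_intros simp: power2_eq_square power4_eq_xxxx)
  have dy: "((\<lambda>t. 1 - (x\<^sup>2 + t\<^sup>2) / R\<^sup>2) has_real_derivative - 2 * y / R\<^sup>2) (at y)" for x y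
    by (cases "R = 0"; auto intro!: derivative_eq_intros simp: power2_eq_square power4_eq_xxxx)
  have px: "((\<lambda>t. cutoff R (t, y, z) ^ (n + 2)) has_real_derivative
      real (n + 2) * cutoff R (x, y, z) ^ (n + 1) * cutoff_deriv R 1 (x, y, z)) (at x)" for x y z
    using DERIV_chain2[OF DERIV_max0_power dx] by (simp add: cutoff_def cutoff_deriv_def del: power_Suc)
  have py: "((\<lambda>t. cutoff R (x, t, z) ^ (n + 2)) has_real_derivative
      real (n + 2) * cutoff R (x, y, z) ^ (n + 1) * cutoff_deriv R 2 (x, y, z)) (at y)" for x y z
    using DERIV_chain2[OF DERIV_max0_power dy] by (simp add: cutoff_def cutoff_deriv_def del: power_Suc)
  have pz: "((\<lambda>t. cutoff R (x, y, t) ^ (n + 2)) has_real_derivative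
      real (n + 2) * cutoff R (x, y, z) ^ (n + 1) * cutoff_deriv R 3 (x, y, z)) (at z within {0..1})" for x y z
    by (simp add: cutoff_def cutoff_deriv_def)
  show ?thesis
    unfolding has_partials_def
    by (intro conjI allI ballI c px py pz continuous_on_mult d continuous_on_const)
qed

section \<open>The divergence theorem on a box spanning the slab\<close>

abbreviation box3 :: "real \<Rightarrow> point set" where
  "box3 R \<equiv> cbox (- R, - R, 0) (R, R, 1)"

lemma box3_subset_slab: "box3 R \<subseteq> slab"
  by (auto simp: slab_def cbox_Pair_eq)

lemma mem_box3: "(x, y, z) \<in> box3 R \<longleftrightarrow> -R \<le> x \<and> x \<le> R \<and> -R \<le> y \<and> y \<le> R \<and> 0 \<le> z \<and> z \<le> 1"
  by (auto simp: cbox_Pair_eq)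

lemma continuous_on_slab_imp_integrable:
  fixes f :: "point \<Rightarrow> real"
  shows "continuous_on slab f \<Longrightarrow> f integrable_on box3 R"
  by (metis box3_subset_slab continuous_on_subset integrable_continuous)

text \<open>The first coordinate is outermost in the iterated integral, so its integral is moved
  inside before the fundamental theorem applies; the second coordinate needs the same exchange one
  level deeper.\<close>

lemma integral_box3_partial_x:
  assumes "has_partials f f'" "R > 0"
    and "\<And>y z. 0 \<le> z \<Longrightarrow> z \<le> 1 \<Longrightarrow> f (R, y, z) = f (- R, y, z)"
  shows "integral (box3 R) (f' 1) = 0"
proof -
  have c: "continuous_on (box3 R) (f' 1)"
    using has_partials_cont(2)[OF assms(1)] box3_subset_slab continuous_on_subset by blast
  have "integral (box3 R) (f' 1) =
      integral (cbox (-R) R) (\<lambda>x. integral (cbox (-R,0) (R,1)) (\<lambda>q. f' 1 (x, q)))"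
    using integral_prod_continuous[OF c] .
  also have "\<dots> = integral (cbox (-R,0) (R,1)) (\<lambda>q. integral (cbox (-R) R) (\<lambda>x. f' 1 (x, q)))"
    using c by (intro integral_swap_continuous) (simp add: split_def)
  also have "\<dots> = integral (cbox (-R,0) (R,1)) (\<lambda>q :: real \<times> real. 0)"
  proof (rule Henstock_Kurzweil_Integration.integral_cong)
    fix q :: "real \<times> real" assume q: "q \<in> cbox (-R,0) (R,1)"
    obtain y z where yz: "q = (y, z)" by force
    hence z: "0 \<le> z" "z \<le> 1" using q by (auto simp: cbox_Pair_eq)
    have "((\<lambda>x. f' 1 (x, q)) has_integral f (R, q) - f (-R, q)) {-R..R}"
      using assms(2) has_partials_deriv(1)[OF assms(1) z] yz
      by (intro fundamental_theorem_of_calculus)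
         (auto simp: has_real_derivative_iff_has_vector_derivative[symmetric] intro: DERIV_subset)
    thus "integral (cbox (-R) R) (\<lambda>x. f' 1 (x, q)) = 0"
      using assms(3)[OF z] yz by (simp add: integral_unique)
  qed
  finally show ?thesis by simp
qed

lemma integral_box3_partial_y:
  assumes "has_partials f f'" "R > 0"
    and "\<And>x z. 0 \<le> z \<Longrightarrow> z \<le> 1 \<Longrightarrow> f (x, R, z) = f (x, - R, z)"
  shows "integral (box3 R) (f' 2) = 0"
proof -
  have c: "continuous_on (box3 R) (f' 2)"
    using has_partials_cont(2)[OF assms(1)] box3_subset_slab continuous_on_subset by blast
  have "integral (box3 R) (f' 2) =
      integral (cbox (-R) R) (\<lambda>x. integral (cbox (-R,0) (R,1)) (\<lambda>q. f' 2 (x, q)))"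
    using integral_prod_continuous[OF c] .
  also have "\<dots> = integral (cbox (-R) R) (\<lambda>x. 0)"
  proof (rule Henstock_Kurzweil_Integration.integral_cong)
    fix x :: real assume x: "x \<in> cbox (-R) R"
    have c2: "continuous_on (cbox (-R,0) (R,1)) (\<lambda>q. f' 2 (x, q))"
      by (rule continuous_on_compose2[OF c]) (use x in \<open>auto intro!: continuous_intros simp: cbox_Pair_eq\<close>)
    have "integral (cbox (-R,0) (R,1)) (\<lambda>q. f' 2 (x, q))
       = integral (cbox (-R) R) (\<lambda>y. integral (cbox 0 1) (\<lambda>z. f' 2 (x, y, z)))"
      using integral_prod_continuous[OF c2] .
    also have "\<dots> = integral (cbox 0 1) (\<lambda>z. integral (cbox (-R) R) (\<lambda>y. f' 2 (x, y, z)))"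
      using c2 by (intro integral_swap_continuous) (simp add: split_def)
    also have "\<dots> = integral (cbox 0 1) (\<lambda>z :: real. 0)"
    proof (rule Henstock_Kurzweil_Integration.integral_cong)
      fix z :: real assume "z \<in> cbox 0 1"
      hence z: "0 \<le> z" "z \<le> 1" by auto
      have "((\<lambda>y. f' 2 (x, y, z)) has_integral f (x, R, z) - f (x, -R, z)) {-R..R}"
        using assms(2) has_partials_deriv(2)[OF assms(1) z]
        by (intro fundamental_theorem_of_calculus)
           (auto simp: has_real_derivative_iff_has_vector_derivative[symmetric] intro: DERIV_subset)
      thus "integral (cbox (-R) R) (\<lambda>y. f' 2 (x, y, z)) = 0"
        using assms(3)[OF z] by (simp add: integral_unique)
    qed
    finally show "integral (cbox (-R,0) (R,1)) (\<lambda>q. f' 2 (x, q)) = 0" by simp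
  qed
  finally show ?thesis by simp
qed

text \<open>A non-integrable function has integral 0 by convention. Nonnegativity therefore passes
  through nested integrals without a proof that the inner ones are integrable in the outer
  variable.\<close>

lemma integral_nonneg_always:
  fixes f :: "'a::euclidean_space \<Rightarrow> real"
  assumes "\<And>x. x \<in> S \<Longrightarrow> 0 \<le> f x"
  shows "0 \<le> integral S f"
proof (cases "f integrable_on S")
  case True
  thus ?thesis using assms by (intro integral_nonneg)
qed (simp add: not_integrable_integral)

text \<open>An inequality rather than an identity, because the friction terms on the walls have a
  sign but do not vanish.\<close>

lemma integral_box3_partial_z:
  assumes "has_partials f f'" "R > 0"
    and "\<And>x y. f (x, y, 0) \<le> f (x, y, 1)"
  shows "0 \<le> integral (box3 R) (f' 3)"
proof -
  have c: "continuous_on (box3 R) (f' 3)"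
    using has_partials_cont(2)[OF assms(1)] box3_subset_slab continuous_on_subset by blast
  have c2: "continuous_on (cbox (-R,0) (R,1)) (\<lambda>q. f' 3 (x, q))" if "x \<in> cbox (-R) R" for x
    by (rule continuous_on_compose2[OF c]) (use that in \<open>auto intro!: continuous_intros simp: cbox_Pair_eq\<close>)
  have "0 \<le> integral (cbox (-R,0) (R,1)) (\<lambda>q. f' 3 (x, q))" if x: "x \<in> cbox (-R) R" for x
  proof -
    have "0 \<le> integral (cbox 0 1) (\<lambda>z. f' 3 (x, y, z))" for y
    proof -
      have "((\<lambda>z. f' 3 (x, y, z)) has_integral f (x, y, 1) - f (x, y, 0)) {0..1}"
        using has_partials_deriv(3)[OF assms(1)]
        by (intro fundamental_theorem_of_calculus)
           (auto simp: has_real_derivative_iff_has_vector_derivative[symmetric])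
      thus ?thesis using assms(3)[of x y] by (simp add: integral_unique)
    qed
    hence "0 \<le> integral (cbox (-R) R) (\<lambda>y. integral (cbox 0 1) (\<lambda>z. f' 3 (x, y, z)))"
      by (rule integral_nonneg_always)
    thus ?thesis using integral_prod_continuous[OF c2[OF x]] by simp
  qed
  hence "0 \<le> integral (cbox (-R) R) (\<lambda>x. integral (cbox (-R,0) (R,1)) (\<lambda>q. f' 3 (x, q)))"
    by (rule integral_nonneg_always)
  thus ?thesis using integral_prod_continuous[OF c] by simp
qed

lemma divergence_integral_nonneg:
  assumes "has_partials X X'" "has_partials Y Y'" "has_partials Z Z'" "R > 0"
    and "\<And>y z. 0 \<le> z \<Longrightarrow> z \<le> 1 \<Longrightarrow> X (R, y, z) = X (- R, y, z)"
    and "\<And>x z. 0 \<le> z \<Longrightarrow> z \<le> 1 \<Longrightarrow> Y (x, R, z) = Y (x, - R, z)"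
    and "\<And>x y. Z (x, y, 0) \<le> Z (x, y, 1)"
  shows "0 \<le> integral (box3 R) (\<lambda>q. X' 1 q + Y' 2 q + Z' 3 q)"
proof -
  have i: "X' 1 integrable_on box3 R" "Y' 2 integrable_on box3 R" "Z' 3 integrable_on box3 R"
    using assms(1-3) has_partials_cont(2) continuous_on_slab_imp_integrable by blast+
  have "integral (box3 R) (\<lambda>q. X' 1 q + Y' 2 q + Z' 3 q)
     = integral (box3 R) (X' 1) + integral (box3 R) (Y' 2) + integral (box3 R) (Z' 3)"
    by (simp add: integral_add i integrable_add)
  thus ?thesis
    using integral_box3_partial_x[OF assms(1,4,5)] integral_box3_partial_y[OF assms(2,4,6)]
      integral_box3_partial_z[OF assms(3,4,7)] by simp
qed

section \<open>Axisymmetric slab flows and their stream function\<close>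

lemma has_partials_vertical_scale:
  assumes "has_partials f f'" "z \<in> {0..1}" "t \<in> {0..1}"
  shows "((\<lambda>s. f (x, y, s * t)) has_real_derivative f' 3 (x, y, z * t) * t) (at z within {0..1})"
proof -
  have "((\<lambda>s. f (x, y, s)) has_real_derivative f' 3 (x, y, z * t)) (at (z * t) within {0..1})"
    using assms by (intro has_partials_deriv(3)) (auto simp: mult_le_one)
  hence "((\<lambda>s. f (x, y, s)) has_real_derivative f' 3 (x, y, z * t)) (at (z * t) within (\<lambda>s. s * t) ` {0..1})"
    by (rule DERIV_subset) (use assms(3) in \<open>auto simp: mult_le_one\<close>)
  moreover have "((\<lambda>s. s * t) has_real_derivative t) (at z within {0..1})"
    by (auto intro!: derivative_eq_intros)
  ultimately show ?thesis
    using DERIV_image_chain by (fastforce simp: o_def)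
qed

lemma continuous_on_vertical_scale:
  assumes "continuous_on slab f" "continuous_on S g" "continuous_on S h" "continuous_on S k" "k ` S \<subseteq> {0..1}"
  shows "continuous_on S (\<lambda>a. f (g a, h a, k a))"
  by (rule continuous_on_compose2[OF assms(1)])
     (use assms in \<open>auto intro!: continuous_intros simp: slab_def\<close>)

text \<open>\<open>d i j\<close> stands for the derivative of component \<open>i\<close> in
  direction \<open>j\<close>, and \<open>dd i j k\<close> for a further derivative in direction
  \<open>k\<close>. Axisymmetry enters as \<open>rotation\<close>, the angular derivative of the
  horizontal components, which stays regular on the axis. The 2 in \<open>slip\<close> cancels the
  1/2 of the strain tensor. The radius \<open>2 * R\<close> in \<open>sublinear\<close> makes the
  bound reach the corners of the square of half-width \<open>R\<close>.\<close>

locale slab_flow =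
  fixes u :: "3 \<Rightarrow> point \<Rightarrow> real"
    and d :: "3 \<Rightarrow> 3 \<Rightarrow> point \<Rightarrow> real"
    and dd :: "3 \<Rightarrow> 3 \<Rightarrow> 3 \<Rightarrow> point \<Rightarrow> real"
    and p :: "point \<Rightarrow> real" and dp :: "3 \<Rightarrow> point \<Rightarrow> real"
    and \<alpha> :: real
  assumes alpha: "\<alpha> > 0"
    and hu: "has_partials (u i) (d i)"
    and hd: "has_partials (d i j) (dd i j)"
    and hp: "has_partials p dp"
    and momentum: "q \<in> slab \<Longrightarrow>
      - (\<Sum>j\<in>UNIV. dd i j j q) + (\<Sum>j\<in>UNIV. u j q * d i j q) + dp i q = 0"
    and divergence_free: "q \<in> slab \<Longrightarrow> (\<Sum>j\<in>UNIV. d j j q) = 0"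
    and no_flux: "u 3 (x, y, 0) = 0" "u 3 (x, y, 1) = 0"
    and slip: "i = 1 \<or> i = 2 \<Longrightarrow> d i 3 (x, y, 0) = 2 * \<alpha> * u i (x, y, 0)"
      "i = 1 \<or> i = 2 \<Longrightarrow> d i 3 (x, y, 1) = - 2 * \<alpha> * u i (x, y, 1)"
    and rotation: "(x, y, z) \<in> slab \<Longrightarrow> x * d 1 2 (x, y, z) - y * d 1 1 (x, y, z) = - u 2 (x, y, z)"
      "(x, y, z) \<in> slab \<Longrightarrow> x * d 2 2 (x, y, z) - y * d 2 1 (x, y, z) = u 1 (x, y, z)"
    and sublinear: "\<epsilon> > 0 \<Longrightarrow> \<exists>R0. \<forall>R\<ge>R0. \<forall>(x, y, z)\<in>slab. x\<^sup>2 + y\<^sup>2 \<le> (2 * R)\<^sup>2 \<longrightarrow>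
      (\<Sum>i\<in>UNIV. (u i (x, y, z))\<^sup>2) \<le> (\<epsilon> * R)\<^sup>2"
begin

definition radial :: "point \<Rightarrow> real" where
  "radial q = fst q * u 1 q + fst (snd q) * u 2 q"

text \<open>\<open>radial\<close> is \<open>r\<close> times the radial velocity. Rotation trades
  \<open>u 1 + y * d 2 1\<close> for \<open>x * d 2 2\<close>, and similarly in the other direction,
  so the horizontal gradient becomes \<open>(x, y)\<close> times \<open>d 1 1 + d 2 2\<close>, which
  is \<open>- d 3 3\<close>. This is the compatibility condition for the stream function.\<close>

lemma has_partials_radial:
  obtains r' where "has_partials radial r'"
    "\<And>x y z. (x, y, z) \<in> slab \<Longrightarrow> r' 1 (x, y, z) = - x * d 3 3 (x, y, z)"
    "\<And>x y z. (x, y, z) \<in> slab \<Longrightarrow> r' 2 (x, y, z) = - y * d 3 3 (x, y, z)"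
proof
  show "has_partials radial (\<lambda>i q. (if i = 1 then 1 else 0) * u 1 q + d 1 i q * fst q +
     ((if i = 2 then 1 else 0) * u 2 q + d 2 i q * fst (snd q)))"
    unfolding radial_def[abs_def] by (intro partials hu)
  fix x y z :: real assume q: "(x, y, z) \<in> slab"
  have e: "d 3 3 (x, y, z) = - d 1 1 (x, y, z) - d 2 2 (x, y, z)"
    using divergence_free[OF q] by (simp add: sum_3)
  show "(if 1 = (1::3) then 1 else 0) * u 1 (x, y, z) + d 1 1 (x, y, z) * fst (x, y, z) +
     ((if 1 = (2::3) then 1 else 0) * u 2 (x, y, z) + d 2 1 (x, y, z) * fst (snd (x, y, z))) = - x * d 3 3 (x, y, z)"
    using rotation(2)[OF q] unfolding e by (simp add: algebra_simps)
  show "(if 2 = (1::3) then 1 else 0) * u 1 (x, y, z) + d 1 2 (x, y, z) * fst (x, y, z) +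
     ((if 2 = (2::3) then 1 else 0) * u 2 (x, y, z) + d 2 2 (x, y, z) * fst (snd (x, y, z))) = - y * d 3 3 (x, y, z)"
    using rotation(1)[OF q] unfolding e by (simp add: algebra_simps)
qed

text \<open>The Stokes stream function \<open>- \<integral>\<^sub>0\<^sup>z (x u\<^sub>1 + y u\<^sub>2) ds\<close>, rescaled to a fixed interval of
  integration so that it can be differentiated under the integral sign in all three variables.\<close>

definition stream :: "point \<Rightarrow> real" where
  "stream = (\<lambda>(x, y, z). - integral {0..1} (\<lambda>t. z * radial (x, y, z * t)))"

definition stream_deriv :: "3 \<Rightarrow> point \<Rightarrow> real" where
  "stream_deriv i q = (if i = 1 then fst q * u 3 q else if i = 2 then fst (snd q) * u 3 q else - radial q)"

lemma has_partials_stream: "has_partials stream stream_deriv"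
proof -
  obtain r' where hr: "has_partials radial r'"
    and r1: "\<And>x y z. (x, y, z) \<in> slab \<Longrightarrow> r' 1 (x, y, z) = - x * d 3 3 (x, y, z)"
    and r2: "\<And>x y z. (x, y, z) \<in> slab \<Longrightarrow> r' 2 (x, y, z) = - y * d 3 3 (x, y, z)"
    by (rule has_partials_radial) blast
  note cr = has_partials_cont(1)[OF hr] and cr' = has_partials_cont(2)[OF hr]
  have S: "(x, y, z * t) \<in> slab" if "z \<in> {0..1}" "t \<in> {0..1}" for x y z t
    using that by (auto simp: slab_def mult_le_one)
  have int: "(\<lambda>t. z * radial (x, y, z * t)) integrable_on {0..1}" if "z \<in> {0..1}" for x y z
    using that by (intro integrable_continuous_interval continuous_intros continuous_on_vertical_scale[OF cr])
      (auto simp: mult_le_one)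
  \<comment> \<open>Impermeability of the floor removes the lower end point, so integrating
    \<open>d 3 3\<close> in height returns \<open>u 3\<close> itself.\<close>
  have ftc: "integral {0..1} (\<lambda>t. z * d 3 3 (x, y, z * t)) = u 3 (x, y, z)" if z: "z \<in> {0..1}" for x y z
  proof -
    have "((\<lambda>t. z * d 3 3 (x, y, z * t)) has_integral u 3 (x, y, z * 1) - u 3 (x, y, z * 0)) {0..1}"
      using has_partials_vertical_scale[OF hu _ z]
      by (intro fundamental_theorem_of_calculus)
         (auto simp: has_real_derivative_iff_has_vector_derivative[symmetric] mult.commute)
    from integral_unique[OF this] show ?thesis
      by (simp only: mult_1_right mult_zero_right no_flux diff_0_right)
  qed
  have dx: "((\<lambda>s. stream (s, y, z)) has_real_derivative x * u 3 (x, y, z)) (at x)"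
    if z: "z \<in> {0..1}" for x y z
  proof -
    have "((\<lambda>s. integral (cbox 0 1) (\<lambda>t. z * radial (s, y, z * t))) has_real_derivative
      integral (cbox 0 1) (\<lambda>t. z * r' 1 (x, y, z * t))) (at x within UNIV)"
    proof (rule leibniz_rule_field_derivative)
      fix s t :: real assume t: "t \<in> cbox 0 1"
      show "((\<lambda>s. z * radial (s, y, z * t)) has_real_derivative z * r' 1 (s, y, z * t)) (at s within UNIV)"
        using has_partials_deriv(1)[OF hr, of "z * t"] z t by (intro DERIV_cmult) (auto simp: mult_le_one)
    next
      show "continuous_on (UNIV \<times> cbox 0 1) (\<lambda>(s, t). z * r' 1 (s, y, z * t))"
        unfolding split_def
        by (intro continuous_intros continuous_on_vertical_scale[OF cr']) (use z in \<open>auto simp: mult_le_one\<close>)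
    qed (use int[OF z] in auto)
    moreover have "integral (cbox 0 1) (\<lambda>t. z * r' 1 (x, y, z * t)) =
      integral (cbox 0 1) (\<lambda>t. - x * (z * d 3 3 (x, y, z * t)))"
      by (rule Henstock_Kurzweil_Integration.integral_cong) (use r1 S[OF z] in \<open>auto simp: algebra_simps\<close>)
    ultimately have "((\<lambda>s. integral {0..1} (\<lambda>t. z * radial (s, y, z * t))) has_real_derivative
      - x * u 3 (x, y, z)) (at x)"
      using ftc[OF z] by simp
    from DERIV_minus[OF this] show ?thesis by (simp add: stream_def)
  qed
  have dy: "((\<lambda>s. stream (x, s, z)) has_real_derivative y * u 3 (x, y, z)) (at y)"
    if z: "z \<in> {0..1}" for x y z
  proof -
    have "((\<lambda>s. integral (cbox 0 1) (\<lambda>t. z * radial (x, s, z * t))) has_real_derivative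
      integral (cbox 0 1) (\<lambda>t. z * r' 2 (x, y, z * t))) (at y within UNIV)"
    proof (rule leibniz_rule_field_derivative)
      fix s t :: real assume t: "t \<in> cbox 0 1"
      show "((\<lambda>s. z * radial (x, s, z * t)) has_real_derivative z * r' 2 (x, s, z * t)) (at s within UNIV)"
        using has_partials_deriv(2)[OF hr, of "z * t"] z t by (intro DERIV_cmult) (auto simp: mult_le_one)
    next
      show "continuous_on (UNIV \<times> cbox 0 1) (\<lambda>(s, t). z * r' 2 (x, s, z * t))"
        unfolding split_def
        by (intro continuous_intros continuous_on_vertical_scale[OF cr']) (use z in \<open>auto simp: mult_le_one\<close>)
    qed (use int[OF z] in auto)
    moreover have "integral (cbox 0 1) (\<lambda>t. z * r' 2 (x, y, z * t)) =
      integral (cbox 0 1) (\<lambda>t. - y * (z * d 3 3 (x, y, z * t)))"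
      by (rule Henstock_Kurzweil_Integration.integral_cong) (use r2 S[OF z] in \<open>auto simp: algebra_simps\<close>)
    ultimately have "((\<lambda>s. integral {0..1} (\<lambda>t. z * radial (x, s, z * t))) has_real_derivative
      - y * u 3 (x, y, z)) (at y)"
      using ftc[OF z] by simp
    from DERIV_minus[OF this] show ?thesis by (simp add: stream_def)
  qed
  have dz: "((\<lambda>s. stream (x, y, s)) has_real_derivative - radial (x, y, z)) (at z within {0..1})"
    if z: "z \<in> {0..1}" for x y z
  proof -
    have "((\<lambda>s. integral (cbox 0 1) (\<lambda>t. s * radial (x, y, s * t))) has_real_derivative
      integral (cbox 0 1) (\<lambda>t. radial (x, y, z * t) + z * (r' 3 (x, y, z * t) * t))) (at z within {0..1})"
    proof (rule leibniz_rule_field_derivative)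
      fix s t :: real assume "s \<in> {0..1}" "t \<in> cbox 0 1"
      thus "((\<lambda>s. s * radial (x, y, s * t)) has_real_derivative
          radial (x, y, s * t) + s * (r' 3 (x, y, s * t) * t)) (at s within {0..1})"
        by (auto intro!: derivative_eq_intros has_partials_vertical_scale[OF hr])
    next
      show "continuous_on ({0..1} \<times> cbox 0 1) (\<lambda>(s, t). radial (x, y, s * t) + s * (r' 3 (x, y, s * t) * t))"
        unfolding split_def
        by (intro continuous_intros continuous_on_vertical_scale[OF cr'] continuous_on_vertical_scale[OF cr])
           (auto simp: mult_le_one)
    qed (use int z in auto)
    \<comment> \<open>The integrand is the derivative in \<open>t\<close> of
      \<open>t * radial (x, y, z * t)\<close>, so its integral is the value at
      \<open>t = 1\<close>.\<close>
    moreover have "((\<lambda>t. radial (x, y, z * t) + z * (r' 3 (x, y, z * t) * t)) has_integral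
        1 * radial (x, y, z * 1) - 0 * radial (x, y, z * 0)) {0..1}"
    proof (rule fundamental_theorem_of_calculus)
      fix t :: real assume t: "t \<in> {0..1}"
      have "((\<lambda>t. radial (x, y, z * t)) has_real_derivative r' 3 (x, y, z * t) * z) (at t within {0..1})"
        using has_partials_vertical_scale[OF hr t z] by (simp add: mult.commute)
      thus "((\<lambda>t. t * radial (x, y, z * t)) has_vector_derivative
          radial (x, y, z * t) + z * (r' 3 (x, y, z * t) * t)) (at t within {0..1})"
        unfolding has_real_derivative_iff_has_vector_derivative[symmetric]
        by (auto intro!: derivative_eq_intros)
    qed simp
    ultimately have "((\<lambda>s. integral {0..1} (\<lambda>t. s * radial (x, y, s * t))) has_real_derivative
        radial (x, y, z)) (at z within {0..1})"
      by (simp add: integral_unique)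
    from DERIV_minus[OF this] show ?thesis by (simp add: stream_def)
  qed
  have cont: "continuous_on slab stream"
    unfolding stream_def split_def
  proof (rule continuous_on_minus)
    have "continuous_on slab (\<lambda>q. integral (cbox 0 1)
        (\<lambda>t. snd (snd q) * radial (fst q, fst (snd q), snd (snd q) * t)))"
      by (rule integral_continuous_on_param, unfold split_def)
         (intro continuous_intros continuous_on_vertical_scale[OF cr], auto simp: slab_def mult_le_one)
    thus "continuous_on slab (\<lambda>q. integral {0..1}
        (\<lambda>t. snd (snd q) * radial (fst q, fst (snd q), snd (snd q) * t)))"
      by simp
  qed
  have cont': "continuous_on slab (stream_deriv i)" for i
    unfolding stream_deriv_def
    by (cases "i = 1"; cases "i = 2"; simp; intro continuous_intros cr has_partials_cont(1)[OF hu])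
  show ?thesis
    using dx dy dz cont cont' by (auto simp: has_partials_def stream_deriv_def)
qed

text \<open>At the floor the prefactor \<open>z\<close> is 0. On the ceiling \<open>u 3 = 0\<close>
  kills both horizontal derivatives, so the stream function is constant there, and on the axis
  \<open>radial\<close> is 0. Physically: no net flux crosses any coaxial cylinder.\<close>

lemma stream_boundary: "stream (x, y, 0) = 0" "stream (x, y, 1) = 0"
proof -
  show "stream (x, y, 0) = 0" by (simp add: stream_def)
  have "((\<lambda>t. stream (t, y, 1)) has_real_derivative 0) (at s)" for y s
    using has_partials_deriv(1)[OF has_partials_stream, of 1 y s] by (simp add: stream_deriv_def no_flux)
  hence "stream (x, y, 1) = stream (0, y, 1)"
    using DERIV_isconst_all by blast
  moreover have "((\<lambda>t. stream (0, t, 1)) has_real_derivative 0) (at s)" for s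
    using has_partials_deriv(2)[OF has_partials_stream, of 1 0 s] by (simp add: stream_deriv_def no_flux)
  hence "stream (0, y, 1) = stream (0, 0, 1)"
    using DERIV_isconst_all[of "\<lambda>t. stream (0, t, 1)"] by blast
  moreover have "stream (0, 0, 1) = 0" by (simp add: stream_def radial_def)
  ultimately show "stream (x, y, 1) = 0" by simp
qed

end

section \<open>The energy inequality\<close>

context slab_flow
begin

definition speed_sq :: "point \<Rightarrow> real" where
  "speed_sq q = (\<Sum>i\<in>UNIV. (u i q)\<^sup>2)"

definition grad_sq :: "point \<Rightarrow> real" where
  "grad_sq q = (\<Sum>i\<in>UNIV. \<Sum>j\<in>UNIV. (d i j q)\<^sup>2)"

lemma continuous_speed_sq: "continuous_on slab speed_sq"
  unfolding speed_sq_def[abs_def] by (intro continuous_intros has_partials_cont[OF hu])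

lemma continuous_grad_sq: "continuous_on slab grad_sq"
  unfolding grad_sq_def[abs_def] by (intro continuous_intros has_partials_cont[OF hd])

text \<open>The remainder, besides the weighted \<open>grad_sq\<close>, of testing the momentum
  equation with \<open>\<phi> u + \<psi> e\<^sub>3\<close>: viscous terms with a derivative on
  \<open>\<phi>\<close> or \<open>\<psi>\<close>, the kinetic energy carried across
  \<open>\<nabla>\<phi>\<close>, and the convection of \<open>u 3\<close> tested with
  \<open>\<psi>\<close>.\<close>

definition transport :: "(3 \<Rightarrow> point \<Rightarrow> real) \<Rightarrow> (point \<Rightarrow> real) \<Rightarrow> (3 \<Rightarrow> point \<Rightarrow> real) \<Rightarrow> point \<Rightarrow> real" where
  "transport \<phi>' \<psi> \<psi>' q =
     (\<Sum>j\<in>UNIV. \<phi>' j q * (\<Sum>i\<in>UNIV. u i q * d i j q)) + (\<Sum>j\<in>UNIV. \<psi>' j q * d 3 j q)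
     - (\<Sum>j\<in>UNIV. \<phi>' j q * u j q) * speed_sq q / 2 + \<psi> q * (\<Sum>j\<in>UNIV. u j q * d 3 j q)"

text \<open>The terms with \<open>\<beta>\<close> are the vertical derivative of
  \<open>2\<beta>(2z - 1)|u|^2\<close>.\<close>

definition energy_density :: "real \<Rightarrow> point \<Rightarrow> real" where
  "energy_density \<beta> q = grad_sq q + 4 * \<beta> * speed_sq q
     + 4 * \<beta> * (2 * snd (snd q) - 1) * (\<Sum>i\<in>UNIV. u i q * d i 3 q)"

text \<open>Given \<open>div u = 0\<close>, the assumption \<open>solenoidal\<close> says that
  \<open>\<phi> u + \<psi> e\<^sub>3\<close> is divergence free. With
  \<open>\<beta> \<le> \<alpha>\<close> at most the available friction is moved into the interior,
  and the unspent part has a sign.\<close>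

lemma energy_inequality:
  assumes h\<phi>: "has_partials \<phi> \<phi>'" and h\<psi>: "has_partials \<psi> \<psi>'" and "R > 0"
    and solenoidal: "\<And>q. q \<in> slab \<Longrightarrow> (\<Sum>j\<in>UNIV. \<phi>' j q * u j q) + \<psi>' 3 q = 0"
    and \<phi>3: "\<And>q. \<phi>' 3 q = 0" and \<phi>_nonneg: "\<And>q. \<phi> q \<ge> 0"
    and lateral: "\<And>y z. \<phi> (R, y, z) = 0" "\<And>y z. \<phi> (-R, y, z) = 0" "\<And>x z. \<phi> (x, R, z) = 0" "\<And>x z. \<phi> (x, -R, z) = 0"
      "\<And>y z. \<psi> (R, y, z) = 0" "\<And>y z. \<psi> (-R, y, z) = 0" "\<And>x z. \<psi> (x, R, z) = 0" "\<And>x z. \<psi> (x, -R, z) = 0"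
    and ends: "\<And>x y. \<psi> (x, y, 0) = 0" "\<And>x y. \<psi> (x, y, 1) = 0"
    and \<beta>: "\<beta> \<le> \<alpha>"
  shows "0 \<le> integral (box3 R) (\<lambda>q. - (\<phi> q * energy_density \<beta> q) - transport \<phi>' \<psi> \<psi>' q)"
proof -
  define w where "w i q = \<phi> q * u i q + (if i = 3 then \<psi> q else 0)" for i q
  define w' where "w' i j q = \<phi>' j q * u i q + d i j q * \<phi> q + (if i = 3 then \<psi>' j q else 0)" for i j q
  have hw: "has_partials (w i) (w' i)" for i
  proof (cases "i = 3")
    case True
    show ?thesis unfolding True w_def[abs_def] w'_def[abs_def] if_P[OF refl]
      by (intro partials h\<phi> h\<psi> hu)
  next
    case False
    show ?thesis using has_partials_mult[OF h\<phi> hu[of i]]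
      unfolding w_def[abs_def] w'_def[abs_def] if_not_P[OF False] by simp
  qed
  have hU: "has_partials speed_sq (\<lambda>j q. \<Sum>i\<in>UNIV. 2 * u i q * d i j q)"
  proof -
    have "has_partials (\<lambda>q. u 1 q * u 1 q + u 2 q * u 2 q + u 3 q * u 3 q)
       (\<lambda>j q. d 1 j q * u 1 q + d 1 j q * u 1 q + (d 2 j q * u 2 q + d 2 j q * u 2 q)
         + (d 3 j q * u 3 q + d 3 j q * u 3 q))"
      by (intro partials hu)
    thus ?thesis unfolding speed_sq_def[abs_def] by (simp add: sum_3 power2_eq_square algebra_simps)
  qed
  text \<open>The momentum equation tested with \<open>w\<close>, in divergence form: the pressure enters only through
    \<open>w p\<close> because \<open>w\<close> is solenoidal. Subtracting \<open>Z\<close> turns the boundary terms \<open>2\<alpha>\<phi>|u|\<^sup>2\<close> into interior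
    control of \<open>|u|\<^sup>2\<close>.\<close>
  define X where "X j q = - (w 1 q * d 1 j q + w 2 q * d 2 j q + w 3 q * d 3 j q)
     + (\<phi> q * u j q) * (1/2 * speed_sq q) + w j q * p q" for j q
  define X' where "X' j i q = - (w' 1 i q * d 1 j q + dd 1 j i q * w 1 q + (w' 2 i q * d 2 j q + dd 2 j i q * w 2 q)
        + (w' 3 i q * d 3 j q + dd 3 j i q * w 3 q))
     + ((\<phi>' i q * u j q + d j i q * \<phi> q) * (1/2 * speed_sq q)
        + (0 * speed_sq q + (\<Sum>k\<in>UNIV. 2 * u k q * d k i q) * (1/2)) * (\<phi> q * u j q))
     + (w' j i q * p q + dp i q * w j q)" for j i q
  have hX: "has_partials (X j) (X' j)" for j
    unfolding X_def[abs_def] X'_def[abs_def] by (intro partials hw hd h\<phi> hu hU hp)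
  define Z where "Z q = (2 * \<beta> * (2 * snd (snd q) - 1)) * (\<phi> q * speed_sq q)" for q
  define Z' where "Z' i q = (0 * (2 * snd (snd q) - 1) + (0 * snd (snd q) + (if i = 3 then 1 else 0) * 2 - 0) * (2 * \<beta>)) * (\<phi> q * speed_sq q)
     + (\<phi>' i q * speed_sq q + (\<Sum>k\<in>UNIV. 2 * u k q * d k i q) * \<phi> q) * (2 * \<beta> * (2 * snd (snd q) - 1))" for i q
  have hZ: "has_partials Z Z'"
    unfolding Z_def[abs_def] Z'_def[abs_def] by (intro partials h\<phi> hU)
  have "0 \<le> integral (box3 R) (\<lambda>q. X' 1 1 q + X' 2 2 q + (X' 3 3 q - Z' 3 q))"
  proof (rule divergence_integral_nonneg[OF hX hX has_partials_diff[OF hX hZ] \<open>R > 0\<close>])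
    fix x y
    \<comment> \<open>Since \<open>w 3\<close> vanishes on the walls, the pressure drops out there.
      Slip gives \<open>X\<close> the outward flux \<open>2\<alpha>\<phi>|u|^2\<close> through each
      wall, of which \<open>Z\<close> removes \<open>2\<beta>\<phi>|u|^2\<close>.\<close>
    have Z0: "X 3 (x, y, 0) - Z (x, y, 0) = 2 * (\<beta> - \<alpha>) * (\<phi> (x, y, 0) * speed_sq (x, y, 0))"
      by (simp add: X_def Z_def w_def no_flux slip ends speed_sq_def sum_3 algebra_simps power2_eq_square)
    have Z1: "X 3 (x, y, 1) - Z (x, y, 1) = 2 * (\<alpha> - \<beta>) * (\<phi> (x, y, 1) * speed_sq (x, y, 1))"
      by (simp add: X_def Z_def w_def no_flux slip ends speed_sq_def sum_3 algebra_simps power2_eq_square)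
    have "0 \<le> \<phi> q * speed_sq q" for q
      using \<phi>_nonneg by (simp add: speed_sq_def sum_nonneg)
    hence "2 * (\<beta> - \<alpha>) * (\<phi> (x, y, 0) * speed_sq (x, y, 0)) \<le> 0" "0 \<le> 2 * (\<alpha> - \<beta>) * (\<phi> (x, y, 1) * speed_sq (x, y, 1))"
      using \<beta> by (simp_all add: mult_nonpos_nonneg)
    thus "X 3 (x, y, 0) - Z (x, y, 0) \<le> X 3 (x, y, 1) - Z (x, y, 1)"
      unfolding Z0 Z1 by linarith
  qed (auto simp: X_def w_def lateral)
  also have "\<dots> = integral (box3 R) (\<lambda>q. - (\<phi> q * energy_density \<beta> q) - transport \<phi>' \<psi> \<psi>' q)"
  proof (rule Henstock_Kurzweil_Integration.integral_cong)
    fix q assume "q \<in> box3 R"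
    hence q: "q \<in> slab" using box3_subset_slab by blast
    \<comment> \<open>Solving for the pressure gradient cancels all second derivatives; the next two
      identities make the coefficient of \<open>p\<close>, the divergence of \<open>w\<close>,
      vanish.\<close>
    have dp_eq: "dp i q = dd i 1 1 q + dd i 2 2 q + dd i 3 3 q - (u 1 q * d i 1 q + u 2 q * d i 2 q + u 3 q * d i 3 q)" for i
      using momentum[OF q, of i] by (simp add: sum_3)
    have d33: "d 3 3 q = - d 1 1 q - d 2 2 q"
      using divergence_free[OF q] by (simp add: sum_3)
    have psi3: "\<psi>' 3 q = - \<phi>' 1 q * u 1 q - \<phi>' 2 q * u 2 q"
      using solenoidal[OF q] by (simp add: sum_3 \<phi>3)
    show "X' 1 1 q + X' 2 2 q + (X' 3 3 q - Z' 3 q) = - (\<phi> q * energy_density \<beta> q) - transport \<phi>' \<psi> \<psi>' q"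
      unfolding X'_def Z'_def energy_density_def transport_def grad_sq_def w_def w'_def
      by (simp add: sum_3 dp_eq d33 psi3 \<phi>3 algebra_simps power2_eq_square)
  qed
  finally show ?thesis .
qed

text \<open>A weighted Poincare inequality in height with constant 1. The function
  \<open>(1 - 2z) k Q^2\<close> vanishes on both walls; its height derivative is
  \<open>- 2 k Q^2 - 2 (1 - 2z) k Q radial\<close>, and \<open>|1 - 2z| \<le> 1\<close> bounds the
  mixed product by \<open>k (Q^2 + radial^2)\<close>.\<close>

lemma stream_poincare:
  assumes hk: "has_partials k k'" and k3: "\<And>q. k' 3 q = 0" and k: "\<And>q. k q \<ge> 0" and "R > 0"
  shows "0 \<le> integral (box3 R) (\<lambda>q. k q * ((radial q)\<^sup>2 - (stream q)\<^sup>2))"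
proof -
  define Z where "Z q = (1 - 2 * snd (snd q)) * (k q * (stream q * stream q))" for q
  define Z' where "Z' i q = (0 - (0 * snd (snd q) + (if i = 3 then 1 else 0) * 2)) * (k q * (stream q * stream q))
     + (k' i q * (stream q * stream q) + (stream_deriv i q * stream q + stream_deriv i q * stream q) * k q)
       * (1 - 2 * snd (snd q))" for i q
  have hZ: "has_partials Z Z'"
    unfolding Z_def[abs_def] Z'_def[abs_def] by (intro partials hk has_partials_stream)
  have "0 \<le> integral (box3 R) (Z' 3)"
    by (rule integral_box3_partial_z[OF hZ \<open>R > 0\<close>]) (simp add: Z_def stream_boundary)
  also have "\<dots> \<le> integral (box3 R) (\<lambda>q. k q * ((radial q)\<^sup>2 - (stream q)\<^sup>2))"
  proof (rule integral_le)
    show "Z' 3 integrable_on box3 R"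
      by (rule continuous_on_slab_imp_integrable[OF has_partials_cont(2)[OF hZ]])
    obtain r' where "has_partials radial r'" by (rule has_partials_radial)
    thus "(\<lambda>q. k q * ((radial q)\<^sup>2 - (stream q)\<^sup>2)) integrable_on box3 R"
      by (intro continuous_on_slab_imp_integrable continuous_intros has_partials_cont(1)[OF hk]
         has_partials_cont(1)[OF has_partials_stream] has_partials_cont(1))
    fix q assume q: "q \<in> box3 R"
    define t where "t = 1 - 2 * snd (snd q)"
    have t: "\<bar>t\<bar> \<le> 1" using q by (cases q) (auto simp: cbox_Pair_eq t_def)
    have "\<bar>t * (stream q * radial q)\<bar> \<le> 1 * \<bar>stream q * radial q\<bar>"
      unfolding abs_mult using t by (intro mult_right_mono) auto
    moreover have "2 * \<bar>stream q * radial q\<bar> \<le> (stream q)\<^sup>2 + (radial q)\<^sup>2"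
      using sum_squares_bound[of "\<bar>stream q\<bar>" "\<bar>radial q\<bar>"] by (simp add: abs_mult)
    ultimately have "- 2 * (stream q)\<^sup>2 - 2 * (t * (stream q * radial q)) \<le> (radial q)\<^sup>2 - (stream q)\<^sup>2"
      by linarith
    from mult_left_mono[OF this k[of q]]
    show "Z' 3 q \<le> k q * ((radial q)\<^sup>2 - (stream q)\<^sup>2)"
      by (simp add: Z'_def stream_deriv_def k3 t_def[symmetric] algebra_simps power2_eq_square)
  qed
  finally show ?thesis .
qed

end

section \<open>Estimate of the transport terms\<close>

text \<open>Pointwise arithmetic detached from the flow: \<open>c\<close> is the cutoff,
  \<open>v\<close> and \<open>n\<close> bound velocity and gradient, and \<open>s\<close> plays the
  role of \<open>|Q| / R\<close>. With \<open>|x|, |y| \<le> R\<close> every term carries at least a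
  factor \<open>1 / R\<close>, and a term cubic in the flow trades one velocity, at most
  \<open>\<epsilon> R\<close>, against it.\<close>

lemma transport_bound:
  fixes c R x y n v s Q \<epsilon> :: real and U :: "3 \<Rightarrow> real" and G :: "3 \<Rightarrow> 3 \<Rightarrow> real"
  assumes c: "0 \<le> c" "c \<le> 1" and R: "R \<ge> 1" and xy: "\<bar>x\<bar> \<le> R" "\<bar>y\<bar> \<le> R"
    and s: "s \<ge> 0" "\<bar>Q\<bar> \<le> R * s"
    and U: "\<And>i. \<bar>U i\<bar> \<le> v" and G: "\<And>i j. \<bar>G i j\<bar> \<le> n" and v: "v \<le> \<epsilon> * R"
    and \<phi>: "\<phi>1 = - (8 * x / R\<^sup>2 * c ^ 3)" "\<phi>2 = - (8 * y / R\<^sup>2 * c ^ 3)"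
    and \<psi>: "\<psi> = - (8 / R\<^sup>2 * c ^ 3 * Q)"
      "\<psi>1 = 48 * x / R ^ 4 * c\<^sup>2 * Q - 8 / R\<^sup>2 * c ^ 3 * (x * U 3)"
      "\<psi>2 = 48 * y / R ^ 4 * c\<^sup>2 * Q - 8 / R\<^sup>2 * c ^ 3 * (y * U 3)"
      "\<psi>3 = 8 / R\<^sup>2 * c ^ 3 * (x * U 1 + y * U 2)"
  shows "\<bar>\<phi>1 * (U 1 * G 1 1 + U 2 * G 2 1 + U 3 * G 3 1) + \<phi>2 * (U 1 * G 1 2 + U 2 * G 2 2 + U 3 * G 3 2)
      + (\<psi>1 * G 3 1 + \<psi>2 * G 3 2 + \<psi>3 * G 3 3) - (\<phi>1 * U 1 + \<phi>2 * U 2) * v\<^sup>2 / 2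
      + \<psi> * (U 1 * G 3 1 + U 2 * G 3 2 + U 3 * G 3 3)\<bar>
    \<le> 100 * (\<epsilon> + 1 / R) * c\<^sup>2 * (v * n + s * n + v\<^sup>2)"
proof -
  have v0: "v \<ge> 0" using U[of 1] by linarith
  have n0: "n \<ge> 0" using G[of 1 1] by linarith
  have eR0: "0 \<le> \<epsilon> * R" using v v0 by linarith
  hence e0: "\<epsilon> \<ge> 0" using R by (simp add: zero_le_mult_iff)
  have c3: "0 \<le> c ^ 3" "c ^ 3 \<le> c\<^sup>2"
    using c by (auto intro: power_decreasing)
  have aux: "\<bar>a / R\<^sup>2 * c ^ 3 * b\<bar> \<le> k * c\<^sup>2 / R * r"
    if "\<bar>a * b\<bar> \<le> R * (k * r)" "k * r \<ge> 0" for a b k r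
  proof -
    have "\<bar>a / R\<^sup>2 * c ^ 3 * b\<bar> = \<bar>a * b\<bar> * c ^ 3 / R\<^sup>2"
      using c by (simp add: abs_mult)
    also have "\<dots> \<le> R * (k * r) * c\<^sup>2 / R\<^sup>2"
      using that c3 R by (intro divide_right_mono mult_mono) auto
    also have "\<dots> = k * c\<^sup>2 / R * r"
      using R by (simp add: power2_eq_square field_simps)
    finally show ?thesis .
  qed
  have b1: "\<bar>\<phi>1\<bar> \<le> 8 * c\<^sup>2 / R * 1"
    using aux[of "8 * x" 1 8 1] xy R by (simp add: \<phi> abs_mult)
  have b2: "\<bar>\<phi>2\<bar> \<le> 8 * c\<^sup>2 / R * 1"
    using aux[of "8 * y" 1 8 1] xy R by (simp add: \<phi> abs_mult)
  have b3: "\<bar>\<psi>\<bar> \<le> 8 * c\<^sup>2 / R * s"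
    using aux[of 8 Q 8 s] s R by (simp add: \<psi> abs_mult)
  have b4: "\<bar>8 / R\<^sup>2 * c ^ 3 * (x * U 3)\<bar> \<le> 8 * c\<^sup>2 / R * v"
    using mult_mono[OF xy(1) U[of 3]] v0 R by (intro aux) (auto simp: abs_mult)
  have b5: "\<bar>8 / R\<^sup>2 * c ^ 3 * (y * U 3)\<bar> \<le> 8 * c\<^sup>2 / R * v"
    using mult_mono[OF xy(2) U[of 3]] v0 R by (intro aux) (auto simp: abs_mult)
  have b6: "\<bar>\<psi>3\<bar> \<le> 16 * c\<^sup>2 / R * v"
  proof -
    have "\<bar>x * U 1 + y * U 2\<bar> \<le> \<bar>x\<bar> * \<bar>U 1\<bar> + \<bar>y\<bar> * \<bar>U 2\<bar>"
      using abs_triangle_ineq[of "x * U 1" "y * U 2"] by (simp add: abs_mult)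
    also have "\<dots> \<le> R * v + R * v"
      using R xy U by (intro add_mono mult_mono) auto
    finally show ?thesis unfolding \<psi> using v0 by (intro aux) (auto simp: abs_mult)
  qed
  have aux2: "\<bar>48 * a / R ^ 4 * c\<^sup>2 * Q\<bar> \<le> 48 * c\<^sup>2 / R * s" if "\<bar>a\<bar> \<le> R" for a
  proof -
    have "\<bar>48 * a / R ^ 4 * c\<^sup>2 * Q\<bar> = 48 * c\<^sup>2 * (\<bar>a\<bar> * \<bar>Q\<bar>) / R ^ 4"
      using R by (simp add: abs_mult)
    also have "\<dots> \<le> 48 * c\<^sup>2 * (R * (R * s)) / R ^ 4"
      using that s R by (intro divide_right_mono mult_left_mono mult_mono) auto
    also have "\<dots> = 48 * c\<^sup>2 / R * s * (1 / R)"
      using R by (simp add: power4_eq_xxxx field_simps power2_eq_square)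
    also have "\<dots> \<le> 48 * c\<^sup>2 / R * s * 1"
      using R s by (intro mult_left_mono) auto
    finally show ?thesis by simp
  qed
  have b7: "\<bar>\<psi>1\<bar> \<le> 48 * c\<^sup>2 / R * s + 8 * c\<^sup>2 / R * v"
    using aux2[OF xy(1)] b4 unfolding \<psi> by linarith
  have b8: "\<bar>\<psi>2\<bar> \<le> 48 * c\<^sup>2 / R * s + 8 * c\<^sup>2 / R * v"
    using aux2[OF xy(2)] b5 unfolding \<psi> by linarith
  have k: "\<bar>U 1 * G i j + U 2 * G i' j' + U 3 * G i'' j''\<bar> \<le> 3 * (v * n)" for i j i' j' i'' j''
  proof -
    have "\<bar>U a * G b e\<bar> \<le> v * n" for a b e
      unfolding abs_mult using U G v0 by (intro mult_mono) auto
    from this[of 1 i j] this[of 2 i' j'] this[of 3 i'' j''] show ?thesis by linarith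
  qed
  define A where "A = c\<^sup>2 / R"
  have A0: "A \<ge> 0" using R by (simp add: A_def)
  have t1: "\<bar>\<phi>1 * (U 1 * G 1 1 + U 2 * G 2 1 + U 3 * G 3 1)\<bar> \<le> 8 * A * (3 * (v * n))"
    unfolding abs_mult[of \<phi>1] using b1 A0 by (intro mult_mono k) (auto simp: A_def)
  have t2: "\<bar>\<phi>2 * (U 1 * G 1 2 + U 2 * G 2 2 + U 3 * G 3 2)\<bar> \<le> 8 * A * (3 * (v * n))"
    unfolding abs_mult[of \<phi>2] using b2 A0 by (intro mult_mono k) (auto simp: A_def)
  have t3: "\<bar>\<psi>1 * G 3 1\<bar> \<le> (48 * A * s + 8 * A * v) * n"
    unfolding abs_mult using b7 A0 s v0 by (intro mult_mono G) (auto simp: A_def)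
  have t4: "\<bar>\<psi>2 * G 3 2\<bar> \<le> (48 * A * s + 8 * A * v) * n"
    unfolding abs_mult using b8 A0 s v0 by (intro mult_mono G) (auto simp: A_def)
  have t5: "\<bar>\<psi>3 * G 3 3\<bar> \<le> (16 * A * v) * n"
    unfolding abs_mult using b6 A0 s v0 by (intro mult_mono G) (auto simp: A_def)
  \<comment> \<open>This is the trade for the two cubic terms \<open>t6\<close> and
    \<open>t7\<close>.\<close>
  have AR: "A * (\<epsilon> * R) = \<epsilon> * c\<^sup>2" using R by (simp add: A_def)
  have t6: "\<bar>(\<phi>1 * U 1 + \<phi>2 * U 2) * v\<^sup>2 / 2\<bar> \<le> 8 * \<epsilon> * c\<^sup>2 * v\<^sup>2"
  proof -
    have "\<bar>\<phi>1\<bar> \<le> 8 * A" "\<bar>\<phi>2\<bar> \<le> 8 * A"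
      using b1 b2 by (auto simp: A_def)
    hence "\<bar>\<phi>1 * U 1\<bar> \<le> 8 * A * (\<epsilon> * R)" "\<bar>\<phi>2 * U 2\<bar> \<le> 8 * A * (\<epsilon> * R)"
      unfolding abs_mult using order_trans[OF U v] A0 by (auto intro: mult_mono)
    hence "\<bar>\<phi>1 * U 1 + \<phi>2 * U 2\<bar> \<le> 16 * \<epsilon> * c\<^sup>2"
      using AR by linarith
    from mult_right_mono[OF this, of "v\<^sup>2"] show ?thesis by (simp add: abs_mult)
  qed
  have t7: "\<bar>\<psi> * (U 1 * G 3 1 + U 2 * G 3 2 + U 3 * G 3 3)\<bar> \<le> 24 * \<epsilon> * c\<^sup>2 * (s * n)"
  proof -
    have "\<bar>\<psi> * (U 1 * G 3 1 + U 2 * G 3 2 + U 3 * G 3 3)\<bar> \<le> 8 * A * s * (3 * (v * n))"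
      unfolding abs_mult[of \<psi>] using b3 A0 s by (intro mult_mono k) (auto simp: A_def)
    also have "\<dots> \<le> 8 * A * s * (3 * ((\<epsilon> * R) * n))"
      using A0 s n0 v by (intro mult_left_mono mult_right_mono) auto
    also have "\<dots> = 24 * (A * (\<epsilon> * R)) * (s * n)" by simp
    finally show ?thesis unfolding AR by simp
  qed
  define B where "B = \<epsilon> * c\<^sup>2"
  define vn where "vn = A * (v * n)"
  define sn where "sn = A * (s * n)"
  define sn' where "sn' = B * (s * n)"
  define vv where "vv = B * v\<^sup>2"
  define rest where "rest = B * (v * n) + A * v\<^sup>2"
  have pos: "vn \<ge> 0" "sn \<ge> 0" "sn' \<ge> 0" "vv \<ge> 0" "rest \<ge> 0"
    using A0 v0 n0 s e0 by (simp_all add: vn_def sn_def sn'_def vv_def B_def rest_def)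
  have rhs: "100 * (\<epsilon> + 1 / R) * c\<^sup>2 * (v * n + s * n + v\<^sup>2)
     = 100 * (vn + sn + sn' + vv + rest)"
    by (simp add: vn_def sn_def sn'_def vv_def B_def A_def rest_def algebra_simps add_divide_distrib)
  have "8 * A * (3 * (v * n)) = 24 * vn" "(48 * A * s + 8 * A * v) * n = 48 * sn + 8 * vn"
    "16 * A * v * n = 16 * vn" "8 * \<epsilon> * c\<^sup>2 * v\<^sup>2 = 8 * vv" "24 * \<epsilon> * c\<^sup>2 * (s * n) = 24 * sn'"
    by (simp_all add: vn_def sn_def sn'_def vv_def B_def algebra_simps)
  note t = t1[unfolded this] t2[unfolded this] t3[unfolded this] t4[unfolded this] t5[unfolded this]
    t6[unfolded this] t7[unfolded this]
  have triangle: "\<bar>a1 + a2 + (a3 + a4 + a5) - a6 + a7\<bar>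
      \<le> \<bar>a1\<bar> + \<bar>a2\<bar> + \<bar>a3\<bar> + \<bar>a4\<bar> + \<bar>a5\<bar> + \<bar>a6\<bar> + \<bar>a7\<bar>" for a1 a2 a3 a4 a5 a6 a7 :: real
    by linarith
  \<comment> \<open>The coefficients add up to 80, 96, 24 and 8, all below 100; \<open>rest\<close>
    is the nonnegative surplus from expanding the product on the right.\<close>
  have le: "24 * vn + 24 * vn + (48 * sn + 8 * vn) + (48 * sn + 8 * vn) + 16 * vn + 8 * vv + 24 * sn'
      \<le> 100 * (vn + sn + sn' + vv + rest)"
    using pos by (simp add: distrib_left)
  show ?thesis unfolding rhs
    by (rule order_trans[OF triangle], rule order_trans[OF add_mono[OF add_mono[OF add_mono[OF add_mono[OF
        add_mono[OF add_mono[OF t(1,2)] t(3)] t(4)] t(5)] t(6)] t(7)] le])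
qed

lemma continuous_cutoff_power: "R > 0 \<Longrightarrow> continuous_on slab (\<lambda>q. cutoff R q ^ n)"
  unfolding cutoff_def by (auto intro!: continuous_intros continuous_on_max)

lemma cutoff_bounds: "0 \<le> cutoff R q" "cutoff R q \<le> 1"
  by (auto simp: cutoff_def)

lemma cutoff_lateral:
  "R > 0 \<Longrightarrow> cutoff R (R, y, z) = 0" "R > 0 \<Longrightarrow> cutoff R (- R, y, z) = 0"
  "R > 0 \<Longrightarrow> cutoff R (x, R, z) = 0" "R > 0 \<Longrightarrow> cutoff R (x, - R, z) = 0"
  by (auto simp: cutoff_def field_simps)

text \<open>Where the cutoff of radius \<open>R\<close> is positive, the one of radius
  \<open>2 * R\<close> is at least 3/4, and \<open>4 * (3/4)^4 > 1\<close>.\<close>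

lemma cutoff_doubling:
  assumes "R > 0"
  shows "(cutoff R q)\<^sup>2 \<le> 4 * cutoff (2 * R) q ^ 4"
proof (cases "cutoff R q = 0")
  case False
  define a where "a = ((fst q)\<^sup>2 + (fst (snd q))\<^sup>2) / R\<^sup>2"
  have "cutoff R q = max 0 (1 - a)" "cutoff (2 * R) q = max 0 (1 - a / 4)"
    by (simp_all add: cutoff_def a_def power_mult_distrib)
  with False have "3 / 4 \<le> cutoff (2 * R) q" by (auto simp: max_def split: if_splits)
  hence "(3 / 4) ^ 4 \<le> cutoff (2 * R) q ^ 4"
    by (intro power_mono) auto
  moreover have "(cutoff R q)\<^sup>2 \<le> 1"
    using cutoff_bounds by (simp add: power_le_one)
  ultimately show ?thesis by (simp add: power4_eq_xxxx)
qed auto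

section \<open>Coercivity and the localized energy inequality\<close>

context slab_flow
begin

definition local_energy :: "real \<Rightarrow> real" where
  "local_energy R = integral (box3 R) (\<lambda>q. cutoff R q ^ 4 * (grad_sq q + speed_sq q))"

lemma speed_sq_nonneg: "0 \<le> speed_sq q"
  by (simp add: speed_sq_def sum_nonneg)

lemma grad_sq_nonneg: "0 \<le> grad_sq q"
  by (simp add: grad_sq_def sum_nonneg)

text \<open>As \<open>|2z - 1| \<le> 1\<close>, the mixed term is at most
  \<open>2\<beta>(|u|^2 + |\<nabla>u|^2)\<close>. This leaves \<open>2\<beta>\<close> for the
  velocity, and \<open>1 - 2\<beta> \<ge> 3/4\<close> for the gradient.\<close>

lemma energy_density_lower:
  assumes "0 \<le> \<beta>" "\<beta> \<le> 1 / 8" "q \<in> box3 R"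
  shows "1 / 2 * grad_sq q + 2 * \<beta> * speed_sq q \<le> energy_density \<beta> q"
proof -
  define t where "t = 2 * snd (snd q) - 1"
  have t: "\<bar>t\<bar> \<le> 1" using assms(3) by (cases q) (auto simp: cbox_Pair_eq t_def)
  have k: "- (2 * (u i q)\<^sup>2 + 2 * (d i 3 q)\<^sup>2) \<le> 4 * t * (u i q * d i 3 q)" for i
  proof -
    have "\<bar>t * (u i q * d i 3 q)\<bar> \<le> 1 * \<bar>u i q * d i 3 q\<bar>"
      unfolding abs_mult[of t] using t by (intro mult_right_mono) auto
    moreover have "2 * \<bar>u i q * d i 3 q\<bar> \<le> (u i q)\<^sup>2 + (d i 3 q)\<^sup>2"
      using sum_squares_bound[of "\<bar>u i q\<bar>" "\<bar>d i 3 q\<bar>"] by (simp add: abs_mult)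
    ultimately show ?thesis by linarith
  qed
  have "- (2 * speed_sq q + 2 * grad_sq q) \<le> 4 * t * (\<Sum>i\<in>UNIV. u i q * d i 3 q)"
  proof -
    have "(\<Sum>i\<in>UNIV. (d i 3 q)\<^sup>2) \<le> grad_sq q"
      unfolding grad_sq_def by (intro sum_mono member_le_sum) auto
    moreover have "(\<Sum>i\<in>UNIV. - (2 * (u i q)\<^sup>2 + 2 * (d i 3 q)\<^sup>2)) \<le> (\<Sum>i\<in>UNIV. 4 * t * (u i q * d i 3 q))"
      by (intro sum_mono k)
    ultimately show ?thesis
      by (simp add: speed_sq_def sum_negf sum.distrib sum_distrib_left[symmetric] del: minus_add_distrib)
  qed
  from mult_left_mono[OF this assms(1)]
  have "- (2 * \<beta> * speed_sq q) - 2 * (\<beta> * grad_sq q) \<le> 4 * \<beta> * t * (\<Sum>i\<in>UNIV. u i q * d i 3 q)"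
    by (simp add: algebra_simps)
  moreover have "\<beta> * grad_sq q \<le> 1 / 8 * grad_sq q"
    using assms grad_sq_nonneg by (intro mult_right_mono) auto
  ultimately show ?thesis
    using grad_sq_nonneg[of q] unfolding energy_density_def t_def by linarith
qed

lemma abs_u_le: "\<bar>u i q\<bar> \<le> sqrt (speed_sq q)"
  unfolding speed_sq_def by (rule real_le_rsqrt) (simp add: member_le_sum[of i UNIV "\<lambda>i. (u i q)\<^sup>2"])

lemma abs_d_le: "\<bar>d i j q\<bar> \<le> sqrt (grad_sq q)"
proof (rule real_le_rsqrt)
  have "(d i j q)\<^sup>2 \<le> (\<Sum>j\<in>UNIV. (d i j q)\<^sup>2)"
    by (rule member_le_sum[of j UNIV "\<lambda>j. (d i j q)\<^sup>2"]) auto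
  also have "\<dots> \<le> grad_sq q" unfolding grad_sq_def
    by (rule member_le_sum[of i UNIV "\<lambda>i. \<Sum>j\<in>UNIV. (d i j q)\<^sup>2"]) (auto intro: sum_nonneg)
  finally show "\<bar>d i j q\<bar>\<^sup>2 \<le> grad_sq q" by simp
qed

lemma cutoff_energy_inequality:
  assumes R: "R \<ge> 1" and \<beta>: "0 < \<beta>" "\<beta> \<le> \<alpha>" "\<beta> \<le> 1 / 8"
    and small: "\<And>x y z. (x, y, z) \<in> slab \<Longrightarrow> x\<^sup>2 + y\<^sup>2 \<le> (2 * R)\<^sup>2 \<Longrightarrow> speed_sq (x, y, z) \<le> (\<epsilon> * R)\<^sup>2"
    and \<epsilon>: "\<epsilon> > 0"
  shows "0 \<le> integral (box3 R) (\<lambda>q. - (cutoff R q ^ 4 * (1 / 2 * grad_sq q + 2 * \<beta> * speed_sq q))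
     + 100 * (\<epsilon> + 1 / R) * (cutoff R q)\<^sup>2 *
        (sqrt (speed_sq q) * sqrt (grad_sq q) + \<bar>stream q\<bar> / R * sqrt (grad_sq q) + speed_sq q))"
    (is "0 \<le> integral _ ?rhs")
proof -
  define \<phi> where "\<phi> q = cutoff R q ^ (2 + 2)" for q
  define \<phi>' where "\<phi>' i q = real (2 + 2) * cutoff R q ^ (2 + 1) * cutoff_deriv R i q" for i q
  have h\<phi>: "has_partials \<phi> \<phi>'"
    unfolding \<phi>_def[abs_def] \<phi>'_def[abs_def] by (rule has_partials_cutoff_power)
  \<comment> \<open>This is \<open>2 g' Q\<close> for
    \<open>g(\<rho>) = (1 - \<rho> / R^2)^4\<close>. The exponents \<open>2 + 2\<close> and
    \<open>1 + 2\<close> are spelled out to match \<open>has_partials_cutoff_power\<close>.\<close>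
  define \<psi> where "\<psi> q = (- 8 / R\<^sup>2) * (cutoff R q ^ (1 + 2) * stream q)" for q
  define \<psi>' where "\<psi>' i q = 0 * (cutoff R q ^ (1 + 2) * stream q)
     + (real (1 + 2) * cutoff R q ^ (1 + 1) * cutoff_deriv R i q * stream q
         + stream_deriv i q * cutoff R q ^ (1 + 2)) * (- 8 / R\<^sup>2)" for i q
  have h\<psi>: "has_partials \<psi> \<psi>'"
    unfolding \<psi>_def[abs_def] \<psi>'_def[abs_def]
    by (intro partials has_partials_cutoff_power has_partials_stream)
  have "0 \<le> integral (box3 R) (\<lambda>q. - (\<phi> q * energy_density \<beta> q) - transport \<phi>' \<psi> \<psi>' q)"
  proof (rule energy_inequality[OF h\<phi> h\<psi>])
    show "(\<Sum>j\<in>UNIV. \<phi>' j q * u j q) + \<psi>' 3 q = 0" for q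
      by (simp add: \<phi>'_def \<psi>'_def sum_3 cutoff_deriv_def stream_deriv_def radial_def algebra_simps
          add_divide_distrib power3_eq_cube)
  qed (use R \<beta> in \<open>auto simp: \<phi>_def \<psi>_def \<phi>'_def cutoff_deriv_def cutoff_lateral cutoff_bounds stream_boundary\<close>)
  also have "\<dots> \<le> integral (box3 R) ?rhs"
  proof (rule integral_le)
    show "(\<lambda>q. - (\<phi> q * energy_density \<beta> q) - transport \<phi>' \<psi> \<psi>' q) integrable_on box3 R"
      unfolding transport_def energy_density_def
      by (intro continuous_on_slab_imp_integrable continuous_intros has_partials_cont[OF h\<phi>]
        has_partials_cont[OF h\<psi>] has_partials_cont[OF hu] has_partials_cont[OF hd]
        continuous_speed_sq continuous_grad_sq) auto
    show "?rhs integrable_on box3 R"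
      using R by (intro continuous_on_slab_imp_integrable continuous_intros continuous_cutoff_power
        has_partials_cont[OF has_partials_stream] continuous_speed_sq continuous_grad_sq) auto
    fix q assume qb: "q \<in> box3 R"
    obtain x y z where q: "q = (x, y, z)" by (cases q) auto
    have xy: "\<bar>x\<bar> \<le> R" "\<bar>y\<bar> \<le> R" using qb by (auto simp: q cbox_Pair_eq)
    \<comment> \<open>Corners of the square lie at distance \<open>sqrt 2 * R\<close>, hence within
      radius \<open>2 * R\<close>.\<close>
    have "x\<^sup>2 \<le> R\<^sup>2" "y\<^sup>2 \<le> R\<^sup>2" "0 \<le> R\<^sup>2"
      using power_mono[OF xy(1), of 2] power_mono[OF xy(2), of 2] by auto
    hence "x\<^sup>2 + y\<^sup>2 \<le> (2 * R)\<^sup>2"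
      unfolding power_mult_distrib by (simp, linarith)
    hence "speed_sq q \<le> (\<epsilon> * R)\<^sup>2"
      using small[of x y z] qb box3_subset_slab[of R] unfolding q by blast
    hence v: "sqrt (speed_sq q) \<le> \<epsilon> * R"
      using \<epsilon> R by (simp add: real_le_lsqrt)
    have st: "\<bar>stream q\<bar> \<le> R * (\<bar>stream q\<bar> / R)" "0 \<le> \<bar>stream q\<bar> / R" using R by auto
    have e1: "\<phi>' 1 q = - (8 * x / R\<^sup>2 * cutoff R q ^ 3)" "\<phi>' 2 q = - (8 * y / R\<^sup>2 * cutoff R q ^ 3)" "\<phi>' 3 q = 0"
      by (simp_all add: \<phi>'_def cutoff_deriv_def q eval_nat_numeral)
    have e2: "\<psi> q = - (8 / R\<^sup>2 * cutoff R q ^ 3 * stream q)"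
      by (simp add: \<psi>_def eval_nat_numeral)
    have e3: "\<psi>' 1 q = 48 * x / R ^ 4 * (cutoff R q)\<^sup>2 * stream q - 8 / R\<^sup>2 * cutoff R q ^ 3 * (x * u 3 q)"
      "\<psi>' 2 q = 48 * y / R ^ 4 * (cutoff R q)\<^sup>2 * stream q - 8 / R\<^sup>2 * cutoff R q ^ 3 * (y * u 3 q)"
      "\<psi>' 3 q = 8 / R\<^sup>2 * cutoff R q ^ 3 * (x * u 1 q + y * u 2 q)"
      using R by (simp_all add: \<psi>'_def cutoff_deriv_def stream_deriv_def radial_def q
          eval_nat_numeral field_simps)
    have "\<bar>transport \<phi>' \<psi> \<psi>' q\<bar> \<le> 100 * (\<epsilon> + 1 / R) * (cutoff R q)\<^sup>2 *
        (sqrt (speed_sq q) * sqrt (grad_sq q) + \<bar>stream q\<bar> / R * sqrt (grad_sq q) + (sqrt (speed_sq q))\<^sup>2)"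
      using transport_bound[OF cutoff_bounds R xy st(2,1) abs_u_le abs_d_le v e1(1,2) e2 e3]
      by (simp add: transport_def sum_3 e1(3) speed_sq_nonneg)
    moreover have "\<phi> q * (1 / 2 * grad_sq q + 2 * \<beta> * speed_sq q) \<le> \<phi> q * energy_density \<beta> q"
      using energy_density_lower[OF _ \<beta>(3) qb] \<beta> by (intro mult_left_mono) (auto simp: \<phi>_def cutoff_bounds)
    ultimately show "- (\<phi> q * energy_density \<beta> q) - transport \<phi>' \<psi> \<psi>' q \<le> ?rhs q"
      by (simp add: \<phi>_def speed_sq_nonneg)
  qed
  finally show ?thesis .
qed

end

section \<open>Doubling and growth of the local energy\<close>

lemma content_box3: "R > 0 \<Longrightarrow> measure lborel (box3 R) = 4 * R\<^sup>2"
  by (simp add: content_Pair power2_eq_square)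

context slab_flow
begin

lemma radial_sq_le:
  assumes "q \<in> box3 R"
  shows "(radial q)\<^sup>2 \<le> 2 * R\<^sup>2 * speed_sq q"
proof -
  obtain x y z where q: "q = (x, y, z)" by (cases q) auto
  have xy: "\<bar>x\<bar> \<le> R" "\<bar>y\<bar> \<le> R" using assms by (auto simp: q cbox_Pair_eq)
  have "x\<^sup>2 \<le> R\<^sup>2" "y\<^sup>2 \<le> R\<^sup>2"
    using power_mono[OF xy(1), of 2] power_mono[OF xy(2), of 2] by auto
  hence "x\<^sup>2 * (u 1 q)\<^sup>2 \<le> R\<^sup>2 * (u 1 q)\<^sup>2" "y\<^sup>2 * (u 2 q)\<^sup>2 \<le> R\<^sup>2 * (u 2 q)\<^sup>2"
    by (auto intro: mult_right_mono)
  moreover have "(radial q)\<^sup>2 \<le> 2 * (x\<^sup>2 * (u 1 q)\<^sup>2 + y\<^sup>2 * (u 2 q)\<^sup>2)"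
    using sum_squares_bound[of "x * u 1 q" "y * u 2 q"]
    by (simp add: radial_def q power2_sum power_mult_distrib)
  moreover have "0 \<le> R\<^sup>2 * (u 3 q)\<^sup>2" by simp
  moreover have "2 * R\<^sup>2 * speed_sq q = 2 * (R\<^sup>2 * (u 1 q)\<^sup>2) + 2 * (R\<^sup>2 * (u 2 q)\<^sup>2) + 2 * (R\<^sup>2 * (u 3 q)\<^sup>2)"
    by (simp add: speed_sq_def sum_3 algebra_simps)
  ultimately show ?thesis by (simp only: distrib_left)
qed

lemma continuous_radial: "continuous_on slab radial"
proof -
  obtain r' where "has_partials radial r'" by (rule has_partials_radial)
  thus ?thesis by (rule has_partials_cont)
qed

text \<open>The stream function only enters through its square, which \<open>stream_poincare\<close> trades for the kinetic
  energy.\<close>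

lemma local_energy_bound:
  assumes R: "R \<ge> 1" and \<beta>: "0 < \<beta>" "\<beta> \<le> \<alpha>" "\<beta> \<le> 1 / 8"
    and small: "\<And>x y z. (x, y, z) \<in> slab \<Longrightarrow> x\<^sup>2 + y\<^sup>2 \<le> (2 * R)\<^sup>2 \<Longrightarrow> speed_sq (x, y, z) \<le> (\<epsilon> * R)\<^sup>2"
    and \<epsilon>: "\<epsilon> > 0" and K: "K \<ge> 0"
    and hk: "has_partials k k'" "\<And>q. k' 3 q = 0" "\<And>q. k q \<ge> 0"
    and G: "continuous_on slab G"
    and le: "\<And>q s. q \<in> box3 R \<Longrightarrow> 0 \<le> s \<Longrightarrow>
      - (cutoff R q ^ 4 * (1 / 2 * grad_sq q + 2 * \<beta> * speed_sq q))
     + 100 * (\<epsilon> + 1 / R) * (cutoff R q)\<^sup>2 *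
        (sqrt (speed_sq q) * sqrt (grad_sq q) + s * sqrt (grad_sq q) + speed_sq q)
     + K * (k q * (2 * speed_sq q - s\<^sup>2)) \<le> - (2 * \<beta> * (cutoff R q ^ 4 * (grad_sq q + speed_sq q))) + G q"
  shows "2 * \<beta> * local_energy R \<le> integral (box3 R) G"
proof -
  let ?a = "\<lambda>q. - (cutoff R q ^ 4 * (1 / 2 * grad_sq q + 2 * \<beta> * speed_sq q))
     + 100 * (\<epsilon> + 1 / R) * (cutoff R q)\<^sup>2 *
        (sqrt (speed_sq q) * sqrt (grad_sq q) + \<bar>stream q\<bar> / R * sqrt (grad_sq q) + speed_sq q)"
  let ?b = "\<lambda>q. k q * ((radial q)\<^sup>2 - (stream q)\<^sup>2)"
  let ?e = "\<lambda>q. cutoff R q ^ 4 * (grad_sq q + speed_sq q)"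
  have R0: "R > 0" using R by simp
  have int: "?a integrable_on box3 R" "?b integrable_on box3 R" "?e integrable_on box3 R" "G integrable_on box3 R"
    "(\<lambda>q. K / R\<^sup>2 * ?b q) integrable_on box3 R" "(\<lambda>q. - (2 * \<beta> * ?e q)) integrable_on box3 R"
    using R by (intro continuous_on_slab_imp_integrable continuous_intros continuous_cutoff_power
      has_partials_cont[OF has_partials_stream] has_partials_cont[OF hk(1)] continuous_radial
      continuous_speed_sq continuous_grad_sq G; simp)+
  \<comment> \<open>\<open>K / R^2\<close> times the Poincare inequality is added: with
    \<open>s = |Q| / R\<close> and \<open>radial^2 \<le> 2 R^2 |u|^2\<close> it supplies a negative
    \<open>s^2\<close> at the price of \<open>2 |u|^2\<close>.\<close>
  have "0 \<le> integral (box3 R) ?a + K / R\<^sup>2 * integral (box3 R) ?b"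
    using cutoff_energy_inequality[OF R \<beta> small \<epsilon>] stream_poincare[OF hk R0] K
    by (intro add_nonneg_nonneg mult_nonneg_nonneg) auto
  also have "\<dots> = integral (box3 R) (\<lambda>q. ?a q + K / R\<^sup>2 * ?b q)"
    by (simp only: integral_add[OF int(1,5)] Henstock_Kurzweil_Integration.integral_mult_right)
  also have "\<dots> \<le> integral (box3 R) (\<lambda>q. - (2 * \<beta> * ?e q) + G q)"
  proof (rule integral_le)
    show "(\<lambda>q. ?a q + K / R\<^sup>2 * ?b q) integrable_on box3 R"
      by (rule integrable_add[OF int(1,5)])
    show "(\<lambda>q. - (2 * \<beta> * ?e q) + G q) integrable_on box3 R"
      by (rule integrable_add[OF int(6,4)])
    fix q assume q: "q \<in> box3 R"
    have "(radial q)\<^sup>2 / R\<^sup>2 \<le> 2 * speed_sq q"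
      using radial_sq_le[OF q] R by (simp add: divide_simps mult_ac)
    hence "((radial q)\<^sup>2 - (stream q)\<^sup>2) / R\<^sup>2 \<le> 2 * speed_sq q - (\<bar>stream q\<bar> / R)\<^sup>2"
      by (simp add: diff_divide_distrib power_divide)
    hence "K * (k q * (((radial q)\<^sup>2 - (stream q)\<^sup>2) / R\<^sup>2)) \<le> K * (k q * (2 * speed_sq q - (\<bar>stream q\<bar> / R)\<^sup>2))"
      using K hk(3) by (intro mult_left_mono) auto
    hence "K / R\<^sup>2 * ?b q \<le> K * (k q * (2 * speed_sq q - (\<bar>stream q\<bar> / R)\<^sup>2))"
      by simp
    thus "?a q + K / R\<^sup>2 * ?b q \<le> - (2 * \<beta> * ?e q) + G q"
      by (rule order_trans[OF add_left_mono le[OF q]]) (use R in auto)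
  qed
  also have "\<dots> = - (2 * \<beta> * local_energy R) + integral (box3 R) G"
    unfolding local_energy_def
    by (simp only: integral_add[OF int(6,4)] integral_neg Henstock_Kurzweil_Integration.integral_mult_right)
  finally show ?thesis by simp
qed

text \<open>Nothing is absorbed here. Every error is bounded by the energy on the double radius
  through \<open>cutoff_doubling\<close>, which preserves the small factor
  \<open>\<epsilon> + 1 / R\<close>.\<close>

lemma local_energy_doubling:
  assumes R: "R \<ge> 1" and \<beta>: "0 < \<beta>" "\<beta> \<le> \<alpha>" "\<beta> \<le> 1 / 8"
    and small: "\<And>x y z. (x, y, z) \<in> slab \<Longrightarrow> x\<^sup>2 + y\<^sup>2 \<le> (2 * R)\<^sup>2 \<Longrightarrow> speed_sq (x, y, z) \<le> (\<epsilon> * R)\<^sup>2"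
    and \<epsilon>: "\<epsilon> > 0"
  shows "2 * \<beta> * local_energy R \<le> 1600 * (\<epsilon> + 1 / R) * local_energy (2 * R)"
proof -
  define \<delta> where "\<delta> = 100 * (\<epsilon> + 1 / R)"
  have \<delta>: "\<delta> \<ge> 0" using \<epsilon> R by (simp add: \<delta>_def)
  let ?e = "\<lambda>q. cutoff (2 * R) q ^ 4 * (grad_sq q + speed_sq q)"
  have c: "continuous_on slab (\<lambda>q. 16 * \<delta> * ?e q)"
    using R by (intro continuous_intros continuous_cutoff_power continuous_grad_sq continuous_speed_sq) auto
  have "2 * \<beta> * local_energy R \<le> integral (box3 R) (\<lambda>q. 16 * \<delta> * ?e q)"
  proof (rule local_energy_bound[OF R \<beta> small \<epsilon> \<delta> has_partials_cutoff_power[of R 0] _ _ c])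
    fix q :: point and s :: real assume s: "0 \<le> s"
    define v where "v = sqrt (speed_sq q)"
    define n where "n = sqrt (grad_sq q)"
    define c where "c = cutoff R q"
    have vn: "speed_sq q = v\<^sup>2" "grad_sq q = n\<^sup>2"
      by (simp_all add: v_def n_def speed_sq_nonneg grad_sq_nonneg)
    \<comment> \<open>With \<open>K = \<delta>\<close> and \<open>k = cutoff^2\<close> the Poincare
      term has the same weight as the errors, so \<open>- s^2\<close> pays for \<open>s * n\<close>.
      The 4 here and the 4 of \<open>cutoff_doubling\<close> make up the 16.\<close>
    have "v * n + s * n + v\<^sup>2 + (2 * v\<^sup>2 - s\<^sup>2) \<le> 4 * (n\<^sup>2 + v\<^sup>2)"
      using sum_squares_bound[of v n] sum_squares_bound[of s n] zero_le_power2[of v] zero_le_power2[of n]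
        zero_le_power2[of s] unfolding distrib_left by linarith
    hence "\<delta> * c\<^sup>2 * (v * n + s * n + v\<^sup>2 + (2 * v\<^sup>2 - s\<^sup>2)) \<le> \<delta> * c\<^sup>2 * (4 * (n\<^sup>2 + v\<^sup>2))"
      using \<delta> by (intro mult_left_mono) auto
    also have "\<dots> \<le> \<delta> * (4 * cutoff (2 * R) q ^ 4) * (4 * (n\<^sup>2 + v\<^sup>2))"
      using \<delta> R cutoff_doubling[of R q] unfolding c_def by (intro mult_right_mono mult_left_mono) auto
    finally have 1: "\<delta> * c\<^sup>2 * (v * n + s * n + v\<^sup>2) + \<delta> * (c\<^sup>2 * (2 * v\<^sup>2 - s\<^sup>2)) \<le> 16 * \<delta> * (cutoff (2 * R) q ^ 4 * (n\<^sup>2 + v\<^sup>2))"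
      by (simp add: algebra_simps)
    have "2 * \<beta> * (n\<^sup>2 + v\<^sup>2) \<le> 1 / 2 * n\<^sup>2 + 2 * \<beta> * v\<^sup>2"
      using mult_right_mono[of "2 * \<beta>" "1 / 2" "n\<^sup>2"] \<beta> by (simp add: distrib_left)
    hence "c ^ 4 * (2 * \<beta> * (n\<^sup>2 + v\<^sup>2)) \<le> c ^ 4 * (1 / 2 * n\<^sup>2 + 2 * \<beta> * v\<^sup>2)"
      by (intro mult_left_mono) auto
    with 1 show "- (cutoff R q ^ 4 * (1 / 2 * grad_sq q + 2 * \<beta> * speed_sq q))
     + 100 * (\<epsilon> + 1 / R) * (cutoff R q)\<^sup>2 *
        (sqrt (speed_sq q) * sqrt (grad_sq q) + s * sqrt (grad_sq q) + speed_sq q)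
     + \<delta> * (cutoff R q ^ (0 + 2) * (2 * speed_sq q - s\<^sup>2))
     \<le> - (2 * \<beta> * (cutoff R q ^ 4 * (grad_sq q + speed_sq q))) + 16 * \<delta> * ?e q"
      unfolding \<delta>_def[symmetric] v_def[symmetric] n_def[symmetric] c_def[symmetric] add_0
      unfolding vn
      by (simp add: algebra_simps)
  qed (auto simp: cutoff_deriv_def cutoff_bounds)
  also have "\<dots> = 16 * \<delta> * integral (box3 R) ?e" by simp
  also have "\<dots> \<le> 16 * \<delta> * local_energy (2 * R)"
    unfolding local_energy_def
  proof (intro mult_left_mono integral_subset_le)
    have "continuous_on slab ?e"
      using R by (intro continuous_intros continuous_cutoff_power continuous_grad_sq continuous_speed_sq) auto
    thus "?e integrable_on box3 R" "?e integrable_on box3 (2 * R)"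
      by (rule continuous_on_slab_imp_integrable)+
  qed (use R \<delta> in \<open>auto simp: cbox_Pair_eq cutoff_bounds grad_sq_nonneg speed_sq_nonneg\<close>)
  finally show ?thesis by (simp add: \<delta>_def)
qed

text \<open>Here no small factor is needed: the gradient is absorbed into the left side, and what is
  left involves only the velocity, which is at most \<open>R\<close> on the box.\<close>

lemma local_energy_growth:
  assumes R: "R \<ge> 1" and \<beta>: "0 < \<beta>" "\<beta> \<le> \<alpha>" "\<beta> \<le> 1 / 8"
    and small: "\<And>x y z. (x, y, z) \<in> slab \<Longrightarrow> x\<^sup>2 + y\<^sup>2 \<le> (2 * R)\<^sup>2 \<Longrightarrow> speed_sq (x, y, z) \<le> R\<^sup>2"
  shows "\<beta> * local_energy R \<le> 480400 * R ^ 4"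
proof -
  define \<delta> where "\<delta> = 100 * (1 + 1 / R)"
  have \<delta>: "0 \<le> \<delta>" "\<delta> \<le> 200" using R by (simp_all add: \<delta>_def field_simps)
  have "2 * \<beta> * local_energy R \<le> integral (box3 R) (\<lambda>q. 240200 * R\<^sup>2)"
  \<comment> \<open>Young's inequality leaves \<open>2 \<delta>^2 s^2\<close> without any cutoff
    weight, hence \<open>k = 1\<close> and \<open>K = 2 \<delta>^2\<close>, which cancels it
    exactly.\<close>
  proof (rule local_energy_bound[where \<epsilon> = 1 and K = "2 * \<delta>\<^sup>2" and k = "\<lambda>q. 1" and k' = "\<lambda>i q. 0"])
    show "speed_sq (x, y, z) \<le> (1 * R)\<^sup>2" if "(x, y, z) \<in> slab" "x\<^sup>2 + y\<^sup>2 \<le> (2 * R)\<^sup>2" for x y z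
      using small[OF that] by simp
    show "has_partials (\<lambda>q. 1) (\<lambda>i q. 0)" by (rule has_partials_const)
    fix q :: point and s :: real assume s: "0 \<le> s" and q: "q \<in> box3 R"
    define v where "v = sqrt (speed_sq q)"
    define n where "n = sqrt (grad_sq q)"
    define c where "c = (cutoff R q)\<^sup>2"
    have c: "0 \<le> c" "c \<le> 1" using cutoff_bounds[of R q] by (auto simp: c_def power_le_one)
    have vn: "speed_sq q = v\<^sup>2" "grad_sq q = n\<^sup>2"
      by (simp_all add: v_def n_def speed_sq_nonneg grad_sq_nonneg)
    have c4: "cutoff R q ^ 4 = c\<^sup>2" by (simp add: c_def flip: power_mult)
    \<comment> \<open>Used for \<open>a = v\<close> and \<open>a = s\<close>, this spends 1/4 of the
      1/2 available for the gradient; the other 1/4 covers \<open>2\<beta>\<close>.\<close>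
    have young: "\<delta> * c * (a * n) \<le> c\<^sup>2 * n\<^sup>2 / 8 + 2 * \<delta>\<^sup>2 * a\<^sup>2" for a
      using zero_le_power2[of "c * n - 4 * \<delta> * a"]
      by (simp add: power2_diff power_mult_distrib algebra_simps)
    have "\<delta> * c * v\<^sup>2 \<le> \<delta> * 1 * v\<^sup>2"
      using \<delta> c by (intro mult_right_mono mult_left_mono) auto
    moreover have "2 * \<beta> * (c\<^sup>2 * n\<^sup>2) \<le> 1 / 4 * (c\<^sup>2 * n\<^sup>2)"
      using \<beta> by (intro mult_right_mono) auto
    moreover have "(6 * \<delta>\<^sup>2 + \<delta>) * v\<^sup>2 \<le> 240200 * R\<^sup>2"
    proof (rule mult_mono)
      \<comment> \<open>Two \<open>\<delta>^2\<close> come from Young and four from the Poincare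
        term; \<open>\<delta> \<le> 200\<close> gives 240200.\<close>
      show "6 * \<delta>\<^sup>2 + \<delta> \<le> 240200"
        using power_mono[OF \<delta>(2,1), of 2] \<delta> by simp
      obtain x y z where xyz: "q = (x, y, z)" by (cases q) auto
      have xy: "\<bar>x\<bar> \<le> R" "\<bar>y\<bar> \<le> R" using q by (auto simp: xyz cbox_Pair_eq)
      have "x\<^sup>2 \<le> R\<^sup>2" "y\<^sup>2 \<le> R\<^sup>2" "0 \<le> R\<^sup>2"
        using power_mono[OF xy(1), of 2] power_mono[OF xy(2), of 2] by auto
      hence "x\<^sup>2 + y\<^sup>2 \<le> (2 * R)\<^sup>2"
        unfolding power_mult_distrib by (simp, linarith)
      thus "v\<^sup>2 \<le> R\<^sup>2"
        using small[of x y z] q box3_subset_slab[of R] unfolding xyz vn[symmetric] by blast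
    qed auto
    moreover note young[of v] young[of s]
    ultimately show "- (cutoff R q ^ 4 * (1 / 2 * grad_sq q + 2 * \<beta> * speed_sq q))
     + 100 * (1 + 1 / R) * (cutoff R q)\<^sup>2 *
        (sqrt (speed_sq q) * sqrt (grad_sq q) + s * sqrt (grad_sq q) + speed_sq q)
     + 2 * \<delta>\<^sup>2 * (1 * (2 * speed_sq q - s\<^sup>2))
     \<le> - (2 * \<beta> * (cutoff R q ^ 4 * (grad_sq q + speed_sq q))) + 240200 * R\<^sup>2"
      unfolding c4 \<delta>_def[symmetric] v_def[symmetric] n_def[symmetric] c_def[symmetric]
      unfolding vn
      by (simp add: algebra_simps)
  qed (use R \<beta> in auto)
  also have "\<dots> = 960800 * R ^ 4"
    using R by (simp add: content_box3 power2_eq_square power4_eq_xxxx)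
  finally show ?thesis by simp
qed

section \<open>The Liouville argument: doubling against growth\<close>

lemma velocity_vanishes:
  assumes "q \<in> slab"
  shows "u i q = 0"
proof -
  define \<beta> where "\<beta> = min \<alpha> (1 / 8)"
  have \<beta>: "0 < \<beta>" "\<beta> \<le> \<alpha>" "\<beta> \<le> 1 / 8" using alpha by (auto simp: \<beta>_def)
  \<comment> \<open>As \<open>51200 = 1600 * 32\<close>, for \<open>1 / R \<le> \<epsilon>\<close>
    the doubling factor is at most \<open>\<beta> / 16\<close>, and division by
    \<open>2\<beta>\<close> leaves 1/32.\<close>
  define \<epsilon> where "\<epsilon> = \<beta> / 51200"
  have \<epsilon>: "\<epsilon> > 0" using \<beta> by (simp add: \<epsilon>_def)
  have sub: "\<exists>R0. \<forall>R\<ge>R0. \<forall>x y z. (x, y, z) \<in> slab \<longrightarrow> x\<^sup>2 + y\<^sup>2 \<le> (2 * R)\<^sup>2 \<longrightarrow>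
    speed_sq (x, y, z) \<le> (e * R)\<^sup>2" if "e > 0" for e
    using sublinear[OF that] unfolding speed_sq_def by fast
  obtain R0 where R0: "\<And>R x y z. R \<ge> R0 \<Longrightarrow> (x, y, z) \<in> slab \<Longrightarrow> x\<^sup>2 + y\<^sup>2 \<le> (2 * R)\<^sup>2 \<Longrightarrow>
    speed_sq (x, y, z) \<le> (\<epsilon> * R)\<^sup>2" using sub[OF \<epsilon>] by blast
  obtain R1 where R1: "\<And>R x y z. R \<ge> R1 \<Longrightarrow> (x, y, z) \<in> slab \<Longrightarrow> x\<^sup>2 + y\<^sup>2 \<le> (2 * R)\<^sup>2 \<Longrightarrow>
    speed_sq (x, y, z) \<le> R\<^sup>2" using sub[OF zero_less_one] unfolding mult_1 by blast
  define Rs where "Rs = Max {1, R0, R1, 51200 / \<beta>}"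
  have Rs: "1 \<le> Rs" "R0 \<le> Rs" "R1 \<le> Rs" "51200 / \<beta> \<le> Rs" by (simp_all add: Rs_def)
  have e_nonneg: "0 \<le> local_energy R" for R
    unfolding local_energy_def
    by (rule integral_nonneg_always) (simp add: cutoff_bounds grad_sq_nonneg speed_sq_nonneg)
  have double: "local_energy R \<le> local_energy (2 * R) / 32" if R: "R \<ge> Rs" for R
  proof -
    have "1 / R \<le> 1 / (51200 / \<beta>)"
      using R Rs \<beta> by (intro divide_left_mono mult_pos_pos) auto
    hence "1 / R \<le> \<epsilon>" by (simp add: \<epsilon>_def)
    hence "1600 * (\<epsilon> + 1 / R) \<le> \<beta> / 16" by (simp add: \<epsilon>_def)
    hence "1600 * (\<epsilon> + 1 / R) * local_energy (2 * R) \<le> \<beta> / 16 * local_energy (2 * R)"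
      by (intro mult_right_mono e_nonneg)
    moreover have "2 * \<beta> * local_energy R \<le> 1600 * (\<epsilon> + 1 / R) * local_energy (2 * R)"
      using R Rs by (intro local_energy_doubling[OF _ \<beta> R0 \<epsilon>]) auto
    ultimately have "\<beta> * local_energy R \<le> \<beta> * (local_energy (2 * R) / 32)" by simp
    thus ?thesis using \<beta> by simp
  qed
  define C where "C = 480400 / \<beta>"
  have growth: "local_energy R \<le> C * R ^ 4" if R: "R \<ge> Rs" for R
    using local_energy_growth[OF _ \<beta> R1, of R] R Rs \<beta> by (simp add: C_def field_simps)
  have iter: "local_energy R \<le> local_energy (2 ^ k * R) / 32 ^ k" if R: "R \<ge> Rs" for R k
  proof (induction k)
    case (Suc k)
    have "Rs \<le> 2 ^ k * R"
      using mult_mono[of 1 "2 ^ k" Rs R] R Rs by simp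
    from divide_right_mono[OF double[OF this], of "32 ^ k"] Suc.IH show ?case
      by (simp add: mult_ac)
  qed auto
  have zero: "local_energy R = 0" if R: "R \<ge> Rs" for R
  proof -
    \<comment> \<open>After \<open>k\<close> doublings growth costs \<open>16^k\<close> and
      iteration gains \<open>32^k\<close>.\<close>
    have "local_energy R \<le> C * R ^ 4 * (1 / 2) ^ k" for k
    proof -
      have "Rs \<le> 2 ^ k * R"
        using mult_mono[of 1 "2 ^ k" Rs R] R Rs by simp
      from divide_right_mono[OF growth[OF this], of "32 ^ k"] iter[OF R, of k]
      have "local_energy R \<le> C * (2 ^ k * R) ^ 4 / 32 ^ k" by simp
      also have "\<dots> = C * R ^ 4 * ((2 ^ 4) ^ k / 32 ^ k)"
        by (simp only: power_mult_distrib flip: power_mult) (simp add: mult.commute)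
      also have "(2 ^ 4) ^ k / 32 ^ k = (1 / 2 :: real) ^ k"
        by (simp flip: power_divide)
      finally show ?thesis .
    qed
    moreover have "(\<lambda>k. C * R ^ 4 * (1 / 2) ^ k) \<longlonglongrightarrow> C * R ^ 4 * 0"
      by (intro tendsto_intros LIMSEQ_power_zero) auto
    ultimately have "local_energy R \<le> C * R ^ 4 * 0"
      by (intro LIMSEQ_le_const) auto
    thus ?thesis using e_nonneg[of R] by simp
  qed
  obtain x y z where q: "q = (x, y, z)" by (cases q) auto
  \<comment> \<open>This choice puts \<open>q\<close> strictly inside the support of the cutoff,
    where a vanishing integrand forces zero velocity.\<close>
  define R where "R = Rs + \<bar>x\<bar> + \<bar>y\<bar>"
  have R: "R \<ge> Rs" "R > 0" using Rs by (auto simp: R_def)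
  have "continuous_on slab (\<lambda>q. cutoff R q ^ 4 * (grad_sq q + speed_sq q))"
    using R by (intro continuous_intros continuous_cutoff_power continuous_grad_sq continuous_speed_sq) auto
  hence cont: "continuous_on (box3 R) (\<lambda>q. cutoff R q ^ 4 * (grad_sq q + speed_sq q))"
    by (rule continuous_on_subset[OF _ box3_subset_slab])
  have "((0, 0, 1 / 2) :: point) \<in> box (- R, - R, 0) (R, R, 1)"
    using R by (simp add: mem_box Basis_prod_def)
  hence "box (- R, - R, 0) (R, R, 1 :: real) \<noteq> {}" by blast
  moreover have "0 \<le> cutoff R q ^ 4 * (grad_sq q + speed_sq q)" for q
    by (simp add: cutoff_bounds grad_sq_nonneg speed_sq_nonneg)
  ultimately have "\<forall>q\<in>box3 R. cutoff R q ^ 4 * (grad_sq q + speed_sq q) = 0"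
    using integral_cbox_eq_0_iff[OF cont] zero[OF R(1)] unfolding local_energy_def by blast
  moreover have "q \<in> box3 R"
    using assms Rs by (auto simp: q mem_box3 slab_def R_def)
  moreover have "cutoff R q > 0"
  proof -
    have "x\<^sup>2 + y\<^sup>2 \<le> (\<bar>x\<bar> + \<bar>y\<bar>)\<^sup>2" by (simp add: power2_sum)
    also have "\<dots> < R\<^sup>2" using Rs by (intro power_strict_mono) (auto simp: R_def)
    finally show ?thesis using R by (simp add: cutoff_def q)
  qed
  ultimately have "speed_sq q = 0"
    using grad_sq_nonneg[of q] speed_sq_nonneg[of q] by fastforce
  thus ?thesis using abs_u_le[of i q] by simp
qed

end

section \<open>The flow of the theorem in coordinates\<close>

definition vec3 :: "point \<Rightarrow> real^3" where
  "vec3 q = vector [fst q, fst (snd q), snd (snd q)]"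

lemma vec3_nth [simp]: "vec3 (x, y, z) $ 1 = x" "vec3 (x, y, z) $ 2 = y" "vec3 (x, y, z) $ 3 = z"
  by (simp_all add: vec3_def)

lemma vec3_expand: "vec3 q = fst q *\<^sub>R axis 1 1 + fst (snd q) *\<^sub>R axis 2 1 + snd (snd q) *\<^sub>R axis 3 1"
  by (simp add: vec3_def vec_eq_iff forall_3 axis_def)

lemma vec3_components: "vec3 (v $ 1, v $ 2, v $ 3) = v"
  by (simp add: vec_eq_iff forall_3)

lemma vec3_in_slab_closed: "vec3 (x, y, z) \<in> slab_closed \<longleftrightarrow> (x, y, z) \<in> slab"
  by (auto simp: slab_closed_def slab_def)

lemma continuous_on_vec3: "continuous_on S vec3"
  unfolding vec3_expand[abs_def] by (intro continuous_intros)

lemma smooth_onD: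
  assumes "smooth_on S f"
  shows "continuous_on S f" "x \<in> S \<Longrightarrow> f differentiable (at x within S)" "smooth_on S (pd S i f)"
proof -
  have C: "Ck_on k S f" for k using assms by (simp add: smooth_on_def)
  show "continuous_on S f" using C[of 0] by simp
  show "f differentiable (at x within S)" if "x \<in> S"
    using C[of "Suc 0"] that by simp
  show "smooth_on S (pd S i f)"
    unfolding smooth_on_def
  proof
    fix k show "Ck_on k S (pd S i f)" using C[of "Suc k"] by simp
  qed
qed

text \<open>The curve stays in the closed slab, so the derivative within the slab composes with it
  even at the walls. It serves for coordinate lines and for horizontal circles about the
  axis.\<close>

lemma DERIV_along_curve:
  assumes f: "smooth_on slab_closed f"
    and a: "(a has_real_derivative a') (at t within T)"
    and b: "(b has_real_derivative b') (at t within T)"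
    and c: "(c has_real_derivative c') (at t within T)"
    and T: "t \<in> T" "\<And>s. s \<in> T \<Longrightarrow> 0 \<le> c s \<and> c s \<le> 1"
  shows "((\<lambda>s. f (vec3 (a s, b s, c s))) has_real_derivative
      a' * D 1 f (vec3 (a t, b t, c t)) + b' * D 2 f (vec3 (a t, b t, c t)) + c' * D 3 f (vec3 (a t, b t, c t)))
      (at t within T)"
proof -
  let ?g = "\<lambda>s. vec3 (a s, b s, c s)"
  let ?L = "frechet_derivative f (at (?g t) within slab_closed)"
  have sub: "?g ` T \<subseteq> slab_closed" using T by (auto simp: slab_closed_def)
  have L: "(f has_derivative ?L) (at (?g t) within slab_closed)"
    using smooth_onD(2)[OF f, of "?g t"] sub T(1) by (auto simp: frechet_derivative_works)
  have g: "(?g has_derivative (\<lambda>s. s *\<^sub>R vec3 (a', b', c'))) (at t within T)"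
    unfolding has_vector_derivative_def[symmetric] vec3_expand fst_conv snd_conv
    by (intro has_vector_derivative_add has_vector_derivative_scaleR[where g' = 0, simplified]
        has_vector_derivative_const a b c)
  have "((\<lambda>s. f (?g s)) has_derivative (\<lambda>s. ?L (s *\<^sub>R vec3 (a', b', c')))) (at t within T)"
    by (rule has_derivative_in_compose[OF g has_derivative_subset[OF L sub]])
  moreover have "?L (s *\<^sub>R vec3 (a', b', c')) = s * (a' * D 1 f (?g t) + b' * D 2 f (?g t) + c' * D 3 f (?g t))" for s
  proof -
    interpret L: bounded_linear ?L by (rule has_derivative_bounded_linear[OF L])
    have "?L (vec3 (a', b', c')) = a' * D 1 f (?g t) + b' * D 2 f (?g t) + c' * D 3 f (?g t)"
      unfolding vec3_expand[of "(a', b', c')"] pd_def by (simp only: L.add L.scaleR fst_conv snd_conv real_scaleR_def)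
    thus ?thesis by (simp only: L.scaleR real_scaleR_def)
  qed
  ultimately show ?thesis
    by (simp add: has_field_derivative_def mult_commute_abs)
qed

lemma smooth_on_has_partials:
  assumes f: "smooth_on slab_closed f"
  shows "has_partials (\<lambda>q. f (vec3 q)) (\<lambda>i q. D i f (vec3 q))"
proof -
  have c: "continuous_on slab (\<lambda>q. h (vec3 q))" if "smooth_on slab_closed h" for h
  proof (rule continuous_on_compose2[OF smooth_onD(1)[OF that] continuous_on_vec3])
    show "vec3 ` slab \<subseteq> slab_closed"
      using vec3_in_slab_closed by (metis image_subsetI surj_pair)
  qed
  have dx: "((\<lambda>t. f (vec3 (t, y, z))) has_real_derivative D 1 f (vec3 (x, y, z))) (at x)"
    if "z \<in> {0..1}" for x y z
    using DERIV_along_curve[where a = "\<lambda>t. t" and b = "\<lambda>t. y" and c = "\<lambda>t. z" and t = x and T = UNIV,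
        OF f DERIV_ident DERIV_const DERIV_const] that by simp
  have dy: "((\<lambda>t. f (vec3 (x, t, z))) has_real_derivative D 2 f (vec3 (x, y, z))) (at y)"
    if "z \<in> {0..1}" for x y z
    using DERIV_along_curve[where a = "\<lambda>t. x" and b = "\<lambda>t. t" and c = "\<lambda>t. z" and t = y and T = UNIV,
        OF f DERIV_const DERIV_ident DERIV_const] that by simp
  have dz: "((\<lambda>t. f (vec3 (x, y, t))) has_real_derivative D 3 f (vec3 (x, y, z))) (at z within {0..1})"
    if "z \<in> {0..1}" for x y z
    by (rule DERIV_cong[OF DERIV_along_curve[where a = "\<lambda>t. x" and b = "\<lambda>t. y" and c = "\<lambda>t. t",
          OF f DERIV_const DERIV_const DERIV_ident that]]) auto
  show ?thesis
    unfolding has_partials_def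
  proof (intro conjI allI ballI)
    show "continuous_on slab (\<lambda>q. f (vec3 q))" by (rule c[OF f])
    show "continuous_on slab (\<lambda>q. D i f (vec3 q))" for i by (rule c[OF smooth_onD(3)[OF f]])
    fix x y z :: real assume z: "z \<in> {0..1}"
    show "((\<lambda>t. f (vec3 (t, y, z))) has_real_derivative D 1 f (vec3 (x, y, z))) (at x)"
      by (rule dx[OF z])
    show "((\<lambda>t. f (vec3 (x, t, z))) has_real_derivative D 2 f (vec3 (x, y, z))) (at y)"
      by (rule dy[OF z])
    show "((\<lambda>t. f (vec3 (x, y, t))) has_real_derivative D 3 f (vec3 (x, y, z))) (at z within {0..1})"
      by (rule dz[OF z])
  qed
qed

text \<open>Extends the equations, given only between the walls, to the walls themselves by
  continuity in height.\<close>

lemma zero_on_closed_slab: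
  fixes g :: "point \<Rightarrow> real"
  assumes "continuous_on slab g" "\<And>x y z. 0 < z \<Longrightarrow> z < 1 \<Longrightarrow> g (x, y, z) = 0" "q \<in> slab"
  shows "g q = 0"
proof -
  obtain x y z where q: "q = (x, y, z)" by (cases q) auto
  have "continuous_on {0..1} (\<lambda>z. g (x, y, z))"
    by (rule continuous_on_vertical_scale[OF assms(1)]) (auto intro!: continuous_intros)
  hence "continuous_on (closure {0<..<1}) (\<lambda>z. g (x, y, z))" by simp
  from continuous_constant_on_closure[OF this, of 0 z] assms(2,3) show ?thesis
    by (auto simp: q slab_def)
qed

section \<open>Consequences of axisymmetry in Cartesian coordinates\<close>

lemma cyl_eq_vec3: "cyl r \<theta> z = vec3 (r * cos \<theta>, r * sin \<theta>, z)"
  by (simp add: cyl_def vec3_def)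

lemma polar_coordinates: "\<exists>\<theta>. x = sqrt (x\<^sup>2 + y\<^sup>2) * cos \<theta> \<and> y = sqrt (x\<^sup>2 + y\<^sup>2) * sin \<theta>"
  using rcis_cmod_Arg[of "Complex x y"]
  by (intro exI[of _ "Arg (Complex x y)"]) (auto simp: complex_eq_iff cmod_def)

text \<open>\<open>a\<close> and \<open>b\<close> are the radial and angular components, read off at
  angle 0, where the moving frame is the Cartesian one.\<close>

lemma axisymmetric_components:
  assumes "axisymmetric u" "r > 0"
  obtains a b where
    "\<And>\<theta>. u (cyl r \<theta> z) $ 1 = a * cos \<theta> - b * sin \<theta>"
    "\<And>\<theta>. u (cyl r \<theta> z) $ 2 = a * sin \<theta> + b * cos \<theta>"
    "\<And>\<theta>. u (cyl r \<theta> z) $ 3 = u (cyl r 0 z) $ 3"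
proof
  fix \<theta>
  define w where "w = u (cyl r \<theta> z)"
  define w0 where "w0 = u (cyl r 0 z)"
  have "w \<bullet> e_r \<theta> = w0 \<bullet> e_r 0 \<and> w \<bullet> e_\<theta> \<theta> = w0 \<bullet> e_\<theta> 0 \<and> w \<bullet> e_z = w0 \<bullet> e_z"
    using assms unfolding axisymmetric_def w_def w0_def by blast
  hence e: "w $ 1 * cos \<theta> + w $ 2 * sin \<theta> = w0 $ 1" "- w $ 1 * sin \<theta> + w $ 2 * cos \<theta> = w0 $ 2" "w $ 3 = w0 $ 3"
    by (simp_all add: inner_vec_def sum_3 e_r_def e_\<theta>_def e_z_def)
  have sc: "sin \<theta> * sin \<theta> + cos \<theta> * cos \<theta> = 1"
    using sin_cos_squared_add[of \<theta>] by (simp add: power2_eq_square)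
  have "w0 $ 1 * cos \<theta> - w0 $ 2 * sin \<theta> = w $ 1 * (sin \<theta> * sin \<theta> + cos \<theta> * cos \<theta>)"
    unfolding e(1,2)[symmetric] by algebra
  thus "u (cyl r \<theta> z) $ 1 = u (cyl r 0 z) $ 1 * cos \<theta> - u (cyl r 0 z) $ 2 * sin \<theta>"
    by (simp only: sc mult_1_right w_def w0_def)
  have "w0 $ 1 * sin \<theta> + w0 $ 2 * cos \<theta> = w $ 2 * (sin \<theta> * sin \<theta> + cos \<theta> * cos \<theta>)"
    unfolding e(1,2)[symmetric] by algebra
  thus "u (cyl r \<theta> z) $ 2 = u (cyl r 0 z) $ 1 * sin \<theta> + u (cyl r 0 z) $ 2 * cos \<theta>"
    by (simp only: sc mult_1_right w_def w0_def)
  show "u (cyl r \<theta> z) $ 3 = u (cyl r 0 z) $ 3" using e by (simp add: w_def w0_def)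
qed

lemma axisymmetric_norm:
  assumes "axisymmetric u" "r \<ge> 0"
  shows "norm (u (cyl r \<theta> z)) = norm (u (cyl r 0 z))"
proof (cases "r = 0")
  case False
  then obtain a b where e:
    "\<And>\<theta>. u (cyl r \<theta> z) $ 1 = a * cos \<theta> - b * sin \<theta>"
    "\<And>\<theta>. u (cyl r \<theta> z) $ 2 = a * sin \<theta> + b * cos \<theta>"
    "\<And>\<theta>. u (cyl r \<theta> z) $ 3 = u (cyl r 0 z) $ 3"
    using axisymmetric_components[OF assms(1), of r z] assms(2) by (metis less_eq_real_def)
  have "(a * cos \<theta> - b * sin \<theta>)\<^sup>2 + (a * sin \<theta> + b * cos \<theta>)\<^sup>2 = (a\<^sup>2 + b\<^sup>2) * ((sin \<theta>)\<^sup>2 + (cos \<theta>)\<^sup>2)"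
    by algebra
  also have "\<dots> = a\<^sup>2 + b\<^sup>2" by (simp only: sin_cos_squared_add mult_1_right)
  finally show ?thesis
    using e(1,2)[of 0] e(3)[of \<theta>] e(1,2)[of \<theta>] by (simp add: norm_vec_def L2_set_def sum_3)
qed (simp add: cyl_def)

text \<open>Off the axis, both sides are the angular derivative of a horizontal component: once by
  the chain rule along the circle, once from its explicit dependence on the angle.\<close>

lemma axisymmetric_rotation:
  assumes u: "\<forall>i. smooth_on slab_closed (\<lambda>x. u x $ i)" and axi: "axisymmetric u" and q: "(x, y, z) \<in> slab"
  shows "x * D 2 (\<lambda>x. u x $ 1) (vec3 (x, y, z)) - y * D 1 (\<lambda>x. u x $ 1) (vec3 (x, y, z)) = - u (vec3 (x, y, z)) $ 2"
    "x * D 2 (\<lambda>x. u x $ 2) (vec3 (x, y, z)) - y * D 1 (\<lambda>x. u x $ 2) (vec3 (x, y, z)) = u (vec3 (x, y, z)) $ 1"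
proof -
  define g1 where "g1 x y = x * D 2 (\<lambda>x. u x $ 1) (vec3 (x, y, z)) - y * D 1 (\<lambda>x. u x $ 1) (vec3 (x, y, z)) + u (vec3 (x, y, z)) $ 2" for x y
  define g2 where "g2 x y = x * D 2 (\<lambda>x. u x $ 2) (vec3 (x, y, z)) - y * D 1 (\<lambda>x. u x $ 2) (vec3 (x, y, z)) - u (vec3 (x, y, z)) $ 1" for x y
  have z: "0 \<le> z" "z \<le> 1" using q by (auto simp: slab_def)
  have off_axis: "g1 x y = 0 \<and> g2 x y = 0" if "x \<noteq> 0 \<or> y \<noteq> 0" for x y
  proof -
    define r where "r = sqrt (x\<^sup>2 + y\<^sup>2)"
    have r: "r > 0" using that by (simp add: r_def sum_power2_gt_zero_iff)
    obtain \<theta> where xy: "x = r * cos \<theta>" "y = r * sin \<theta>"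
      using polar_coordinates unfolding r_def by blast
    obtain a b where e: "\<And>\<theta>. u (cyl r \<theta> z) $ 1 = a * cos \<theta> - b * sin \<theta>"
      "\<And>\<theta>. u (cyl r \<theta> z) $ 2 = a * sin \<theta> + b * cos \<theta>"
      using axisymmetric_components[OF axi r] by metis
    have ch: "((\<lambda>s. u (cyl r s z) $ i) has_real_derivative
       - r * sin \<theta> * D 1 (\<lambda>x. u x $ i) (vec3 (x, y, z)) + r * cos \<theta> * D 2 (\<lambda>x. u x $ i) (vec3 (x, y, z))) (at \<theta>)" for i
    proof -
      have "((\<lambda>s. u (vec3 (r * cos s, r * sin s, z)) $ i) has_real_derivative
        (- r * sin \<theta>) * D 1 (\<lambda>x. u x $ i) (vec3 (r * cos \<theta>, r * sin \<theta>, z))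
        + (r * cos \<theta>) * D 2 (\<lambda>x. u x $ i) (vec3 (r * cos \<theta>, r * sin \<theta>, z))
        + 0 * D 3 (\<lambda>x. u x $ i) (vec3 (r * cos \<theta>, r * sin \<theta>, z))) (at \<theta> within UNIV)"
        by (rule DERIV_along_curve) (use u z in \<open>auto intro!: derivative_eq_intros\<close>)
      thus ?thesis by (simp add: cyl_eq_vec3 xy)
    qed
    have "((\<lambda>s. u (cyl r s z) $ 1) has_real_derivative - (a * sin \<theta> + b * cos \<theta>)) (at \<theta>)"
      unfolding e by (auto intro!: derivative_eq_intros)
    from DERIV_unique[OF ch this] have "g1 x y = 0"
      by (simp add: g1_def xy flip: e(2)) (simp add: cyl_eq_vec3 xy)
    moreover have "((\<lambda>s. u (cyl r s z) $ 2) has_real_derivative a * cos \<theta> - b * sin \<theta>) (at \<theta>)"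
      unfolding e by (auto intro!: derivative_eq_intros)
    from DERIV_unique[OF ch this] have "g2 x y = 0"
      by (simp add: g2_def xy flip: e(1)) (simp add: cyl_eq_vec3 xy)
    ultimately show ?thesis by blast
  qed
  \<comment> \<open>\<open>axisymmetric\<close> speaks of positive radii only, so the axis is
    reached by a limit along the positive first coordinate axis.\<close>
  have c: "continuous_on {0..} (\<lambda>t. h (vec3 (t, 0, z)))" if "smooth_on slab_closed h" for h
    by (rule continuous_on_vertical_scale[OF has_partials_cont(1)[OF smooth_on_has_partials[OF that]]])
       (use z in \<open>auto intro!: continuous_intros\<close>)
  have cu: "continuous_on {0..} (\<lambda>t. u (vec3 (t, 0, z)) $ i)"
    "continuous_on {0..} (\<lambda>t. D j (\<lambda>x. u x $ i) (vec3 (t, 0, z)))" for i j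
    using u c smooth_onD(3) by blast+
  have cl: "closure {0<..} = {0::real..}" by (rule closure_greaterThan)
  have "continuous_on (closure {0<..}) (\<lambda>t. g1 t 0)" "continuous_on (closure {0<..}) (\<lambda>t. g2 t 0)"
    unfolding g1_def g2_def cl by (intro continuous_intros cu)+
  hence "g1 0 0 = 0" "g2 0 0 = 0"
    using continuous_constant_on_closure[of "{0<..}" "\<lambda>t. g1 t 0" 0 0]
      continuous_constant_on_closure[of "{0<..}" "\<lambda>t. g2 t 0" 0 0] off_axis by (auto simp: cl)
  with off_axis have "g1 x y = 0" "g2 x y = 0" by metis+
  thus "x * D 2 (\<lambda>x. u x $ 1) (vec3 (x, y, z)) - y * D 1 (\<lambda>x. u x $ 1) (vec3 (x, y, z)) = - u (vec3 (x, y, z)) $ 2"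
    "x * D 2 (\<lambda>x. u x $ 2) (vec3 (x, y, z)) - y * D 1 (\<lambda>x. u x $ 2) (vec3 (x, y, z)) = u (vec3 (x, y, z)) $ 1"
    by (auto simp: g1_def g2_def)
qed

text \<open>The limit controls one circle at a time, whereas the bound is needed on the full disc.
  Beyond \<open>R2\<close> the limit is used with \<open>\<epsilon> / 2\<close>, since radii go up
  to \<open>2 * R\<close>; within \<open>R2\<close> compactness gives a constant \<open>C\<close>,
  which is below \<open>\<epsilon> * R\<close> for large \<open>R\<close>.\<close>

lemma axisymmetric_sublinear:
  assumes u: "\<forall>i. smooth_on slab_closed (\<lambda>x. u x $ i)" and axi: "axisymmetric u"
    and lim: "((\<lambda>R. (SUP z\<in>{0..1}. norm (u (cyl R 0 z))) / R) \<longlongrightarrow> 0) at_top"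
    and \<epsilon>: "\<epsilon> > 0"
  shows "\<exists>R0. \<forall>R\<ge>R0. \<forall>(x, y, z)\<in>slab. x\<^sup>2 + y\<^sup>2 \<le> (2 * R)\<^sup>2 \<longrightarrow>
      (\<Sum>i\<in>UNIV. (u (vec3 (x, y, z)) $ i)\<^sup>2) \<le> (\<epsilon> * R)\<^sup>2"
proof -
  have cont: "continuous_on slab (\<lambda>q. norm (u (vec3 q)))"
    unfolding norm_vec_def L2_set_def
    using u by (intro continuous_intros has_partials_cont(1)[OF smooth_on_has_partials]) auto
  \<comment> \<open>The supremum dominates the values only if they are bounded above, which follows
    from continuity on the closed interval.\<close>
  have bdd: "bdd_above ((\<lambda>z. norm (u (cyl r 0 z))) ` {0..1})" for r
  proof -
    have "continuous_on {0..1} (\<lambda>z. norm (u (vec3 (r, 0, z))))"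
      by (rule continuous_on_vertical_scale[OF cont]) (auto intro!: continuous_intros)
    hence "compact ((\<lambda>z. norm (u (cyl r 0 z))) ` {0..1})"
      by (simp add: cyl_eq_vec3 compact_continuous_image)
    thus ?thesis by (rule bounded_imp_bdd_above[OF compact_imp_bounded])
  qed
  have "eventually (\<lambda>R. (SUP z\<in>{0..1}. norm (u (cyl R 0 z))) / R < \<epsilon> / 2) at_top"
    using order_tendstoD(2)[OF lim, of "\<epsilon> / 2"] \<epsilon> by simp
  then obtain R1 where R1: "\<And>R. R \<ge> R1 \<Longrightarrow> (SUP z\<in>{0..1}. norm (u (cyl R 0 z))) / R < \<epsilon> / 2"
    by (auto simp: eventually_at_top_linorder)
  define R2 where "R2 = max 1 R1"
  have far: "norm (u (cyl r 0 z)) \<le> \<epsilon> / 2 * r" if "r \<ge> R2" "z \<in> {0..1}" for r z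
  proof -
    have "norm (u (cyl r 0 z)) \<le> (SUP z\<in>{0..1}. norm (u (cyl r 0 z)))"
      by (rule cSUP_upper[OF that(2) bdd])
    also have "\<dots> \<le> \<epsilon> / 2 * r"
      using R1[of r] that by (simp add: R2_def field_simps)
    finally show ?thesis .
  qed
  have "continuous_on ({0..R2} \<times> {0..1}) (\<lambda>a. norm (u (vec3 (fst a, 0, snd a))))"
    by (rule continuous_on_vertical_scale[OF cont]) (auto intro!: continuous_intros)
  hence "compact ((\<lambda>a. norm (u (vec3 (fst a, 0, snd a)))) ` ({0..R2} \<times> {0..1}))"
    by (intro compact_continuous_image compact_Times) auto
  hence "bdd_above ((\<lambda>a. norm (u (vec3 (fst a, 0, snd a)))) ` ({0..R2} \<times> {0..1}))"
    by (rule bounded_imp_bdd_above[OF compact_imp_bounded])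
  then obtain C where C: "\<forall>b\<in>(\<lambda>a. norm (u (vec3 (fst a, 0, snd a)))) ` ({0..R2} \<times> {0..1}). b \<le> C"
    unfolding bdd_above_def by blast
  have near: "norm (u (cyl r 0 z)) \<le> C" if "0 \<le> r" "r \<le> R2" "z \<in> {0..1}" for r z
    using C[rule_format, OF imageI, of "(r, z)"] that by (simp add: cyl_eq_vec3)
  have key: "(\<Sum>i\<in>UNIV. (u (vec3 (x, y, z)) $ i)\<^sup>2) \<le> (\<epsilon> * R)\<^sup>2"
    if R: "max R2 (C / \<epsilon>) \<le> R" and q: "(x, y, z) \<in> slab" and xy: "x\<^sup>2 + y\<^sup>2 \<le> (2 * R)\<^sup>2" for R x y z
  proof -
    define r where "r = sqrt (x\<^sup>2 + y\<^sup>2)"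
    have R0: "R > 0" using R by (auto simp: R2_def)
    have r: "0 \<le> r" "r \<le> 2 * R"
      using R0 xy by (auto simp: r_def intro!: real_le_lsqrt)
    obtain \<theta> where "x = r * cos \<theta>" "y = r * sin \<theta>"
      using polar_coordinates unfolding r_def by blast
    hence "norm (u (vec3 (x, y, z))) = norm (u (cyl r 0 z))"
      using axisymmetric_norm[OF axi r(1), of \<theta> z] by (simp add: cyl_eq_vec3)
    also have "\<dots> \<le> \<epsilon> * R"
    proof (cases "r \<ge> R2")
      case True
      have "norm (u (cyl r 0 z)) \<le> \<epsilon> / 2 * r" using far[OF True] q by (simp add: slab_def)
      also have "\<dots> \<le> \<epsilon> / 2 * (2 * R)" using \<epsilon> r by (intro mult_left_mono) auto
      finally show ?thesis by simp
    next
      case False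
      hence "norm (u (cyl r 0 z)) \<le> C" using near[OF r(1)] q by (simp add: slab_def)
      also have "\<dots> \<le> \<epsilon> * R" using R \<epsilon> by (simp add: field_simps)
      finally show ?thesis .
    qed
    finally have "(norm (u (vec3 (x, y, z))))\<^sup>2 \<le> (\<epsilon> * R)\<^sup>2"
      by (intro power_mono) auto
    thus ?thesis by (simp add: norm_vec_def L2_set_def sum_nonneg)
  qed
  show ?thesis
  proof (intro exI[of _ "max R2 (C / \<epsilon>)"] allI impI ballI)
    fix R q assume "max R2 (C / \<epsilon>) \<le> R" "q \<in> slab"
    thus "case q of (x, y, z) \<Rightarrow> x\<^sup>2 + y\<^sup>2 \<le> (2 * R)\<^sup>2 \<longrightarrow>
      (\<Sum>i\<in>UNIV. (u (vec3 (x, y, z)) $ i)\<^sup>2) \<le> (\<epsilon> * R)\<^sup>2"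
      using key by (cases q) (simp only: prod.case, blast)
  qed
qed

theorem theorem1p3:
  fixes u :: "real^3 \<Rightarrow> real^3" and P :: "real^3 \<Rightarrow> real" and \<alpha> :: real
  assumes "\<alpha> > 0"
    and "\<forall>i. smooth_on slab_closed (\<lambda>x. u x $ i)"
    and "smooth_on slab_closed P"
    and "axisymmetric u"
    and "stationary_NS u P"
    and "navier_bc \<alpha> u"
    and "((\<lambda>R. (SUP z\<in>{0..1}. norm (u (cyl R 0 z))) / R) \<longlongrightarrow> 0) at_top"
  shows "\<forall>x\<in>slab_open. u x = 0"
proof -
  note su = assms(2)[rule_format] and bc = assms(6)[unfolded navier_bc_def]
  note hu = smooth_on_has_partials[OF su]
    and hd = smooth_on_has_partials[OF smooth_onD(3)[OF su]]
    and hP = smooth_on_has_partials[OF assms(3)]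
  note c = has_partials_cont[OF hu] has_partials_cont[OF hd] has_partials_cont[OF hP]
  have ns: "- (\<Sum>j\<in>UNIV. D j (D j (\<lambda>x. u x $ i)) (vec3 (x, y, z)))
        + (\<Sum>j\<in>UNIV. u (vec3 (x, y, z)) $ j * D j (\<lambda>x. u x $ i) (vec3 (x, y, z))) + D i P (vec3 (x, y, z)) = 0"
      "(\<Sum>j\<in>UNIV. D j (\<lambda>x. u x $ j) (vec3 (x, y, z))) = 0"
    if "0 < z" "z < 1" for x y z i
  proof -
    have "vec3 (x, y, z) \<in> slab_open" using that by (simp add: slab_open_def)
    note bspec[OF assms(5)[unfolded stationary_NS_def] this]
    thus "- (\<Sum>j\<in>UNIV. D j (D j (\<lambda>x. u x $ i)) (vec3 (x, y, z)))
        + (\<Sum>j\<in>UNIV. u (vec3 (x, y, z)) $ j * D j (\<lambda>x. u x $ i) (vec3 (x, y, z))) + D i P (vec3 (x, y, z)) = 0"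
      "(\<Sum>j\<in>UNIV. D j (\<lambda>x. u x $ j) (vec3 (x, y, z))) = 0"
      by blast+
  qed
  interpret slab_flow "\<lambda>i q. u (vec3 q) $ i" "\<lambda>i j q. D j (\<lambda>x. u x $ i) (vec3 q)"
    "\<lambda>i j k q. D k (D j (\<lambda>x. u x $ i)) (vec3 q)" "\<lambda>q. P (vec3 q)" "\<lambda>i q. D i P (vec3 q)" \<alpha>
  proof
    fix q i assume q: "q \<in> slab"
    show "- (\<Sum>j\<in>UNIV. D j (D j (\<lambda>x. u x $ i)) (vec3 q)) + (\<Sum>j\<in>UNIV. u (vec3 q) $ j * D j (\<lambda>x. u x $ i) (vec3 q))
        + D i P (vec3 q) = 0"
    proof (rule zero_on_closed_slab[OF _ _ q])
      show "continuous_on slab (\<lambda>q. - (\<Sum>j\<in>UNIV. D j (D j (\<lambda>x. u x $ i)) (vec3 q))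
          + (\<Sum>j\<in>UNIV. u (vec3 q) $ j * D j (\<lambda>x. u x $ i) (vec3 q)) + D i P (vec3 q))"
        by (intro continuous_on_add continuous_on_minus continuous_on_sum continuous_on_mult c)
    qed (rule ns(1))
    show "(\<Sum>j\<in>UNIV. D j (\<lambda>x. u x $ j) (vec3 q)) = 0"
    proof (rule zero_on_closed_slab[OF _ _ q])
      show "continuous_on slab (\<lambda>q. \<Sum>j\<in>UNIV. D j (\<lambda>x. u x $ j) (vec3 q))"
        by (intro continuous_on_sum c)
    qed (rule ns(2))
  next
    fix x y
    have v: "vec3 (x, y, 0) \<in> slab_closed" "vec3 (x, y, 1) \<in> slab_closed"
      by (auto simp: slab_closed_def)
    show "u (vec3 (x, y, 0)) $ 3 = 0" "u (vec3 (x, y, 1)) $ 3 = 0"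
      using bc v by auto
    fix i :: 3 assume "i = 1 \<or> i = 2"
    thus "D 3 (\<lambda>x. u x $ i) (vec3 (x, y, 0)) = 2 * \<alpha> * u (vec3 (x, y, 0)) $ i"
      "D 3 (\<lambda>x. u x $ i) (vec3 (x, y, 1)) = - 2 * \<alpha> * u (vec3 (x, y, 1)) $ i"
      using bc[rule_format, OF v(1)] bc[rule_format, OF v(2)] by auto
  next
    fix x y z assume "(x, y, z) \<in> slab"
    thus "x * D 2 (\<lambda>x. u x $ 1) (vec3 (x, y, z)) - y * D 1 (\<lambda>x. u x $ 1) (vec3 (x, y, z)) = - u (vec3 (x, y, z)) $ 2"
      "x * D 2 (\<lambda>x. u x $ 2) (vec3 (x, y, z)) - y * D 1 (\<lambda>x. u x $ 2) (vec3 (x, y, z)) = u (vec3 (x, y, z)) $ 1"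
      using axisymmetric_rotation[OF assms(2,4)] by blast+
  next
    fix \<epsilon> :: real assume "\<epsilon> > 0"
    thus "\<exists>R0. \<forall>R\<ge>R0. \<forall>(x, y, z)\<in>slab. x\<^sup>2 + y\<^sup>2 \<le> (2 * R)\<^sup>2 \<longrightarrow>
      (\<Sum>i\<in>UNIV. (u (vec3 (x, y, z)) $ i)\<^sup>2) \<le> (\<epsilon> * R)\<^sup>2"
      by (rule axisymmetric_sublinear[OF assms(2,4,7)])
  qed (rule assms(1) hu hd hP)+
  show ?thesis
  proof
    fix x assume "x \<in> slab_open"
    hence "(x $ 1, x $ 2, x $ 3) \<in> slab" by (auto simp: slab_open_def slab_def)
    from velocity_vanishes[OF this] show "u x = 0"
      by (simp add: vec_eq_iff vec3_components)
  qed
qed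

end
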